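(* Let $\mathscr{L}H=L(H)\rtimes H$ be a finitely generated halo product with $\mathscr{L}$ full and $L(H)$ locally finite. Then every one-ended finitely presented subgroup of $\mathscr{L}H$ is conjugate (in $\mathscr{L}H$) to a subgroup of $H$.
   Context: Halo products: let $H$ be a group. A halo of groups $\mathscr{L}$ over $H$ is the data, for every subset $S \subset H$, of a group $L(S)$ such that: (i) if $R \subset S \subset H$ then $L(R) \leq L(S)$; (ii) $L(\emptyset)=\{1\}$ and $L(H)=\langle L(S) : S \subset H \text{ finite}\rangle$; (iii) $L(R)\cap L(S)=L(R\cap S)$ for all $R,S\subset H$. Given a morphism $\alpha : H \to \mathrm{Aut}(L(H))$ with $\alpha(h)(L(S))=L(hS)$ for all $h\in H$, $S\subset H$, the halo product $\mathscr{L}H$ is the semidirect product $L(H)\rtimes_\alpha H$. If $\mathscr{L}H$ is finitely generated, then so is $H$, and $H$ is endowed with a word metric coming from a finite generating set. Full: a halo of groups $\mathscr{L}$ over a metric space $X$ is full if there exists $K\ge 0$ such that, for all subsets $R,S,T,U\subset X$, if $d(R,S),d(R,T),d(R,U),d(S,T)\ge K$ then $L(R\cup S)L(U)\cap L(R\cup T)\subset L(R)L(T)$ (products of subsets of $L(X)$). *)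

theory Defs
  imports
    "HOL-Algebra.Bij"
    "HOL-Algebra.Generated_Groups"
    "HOL-Library.Extended_Real"
    "HOL-Library.Extended_Nat"
begin

section \<open>Generation, word metrics\<close>

definition finite_generating_set :: "('a, 'b) monoid_scheme \<Rightarrow> 'a set \<Rightarrow> bool" where
  "finite_generating_set G A \<longleftrightarrow> finite A \<and> A \<subseteq> carrier G \<and> generate G A = carrier G"

definition finitely_generated :: "('a, 'b) monoid_scheme \<Rightarrow> bool" where
  "finitely_generated G \<longleftrightarrow> (\<exists>A. finite_generating_set G A)"

definition locally_finite_group :: "('a, 'b) monoid_scheme \<Rightarrow> bool" where
  "locally_finite_group G \<longleftrightarrow> (\<forall>A. finite A \<and> A \<subseteq> carrier G \<longrightarrow> finite (generate G A))"

definition word_length :: "('a, 'b) monoid_scheme \<Rightarrow> 'a set \<Rightarrow> 'a \<Rightarrow> nat" where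
  "word_length G A x =
     (LEAST n. \<exists>w. length w = n \<and> set w \<subseteq> A \<union> m_inv G ` A \<and> foldr (\<otimes>\<^bsub>G\<^esub>) w \<one>\<^bsub>G\<^esub> = x)"

(* The left-invariant word metric, i.e. the metric of the Cayley graph with edges {x, xa}. *)
definition word_dist :: "('a, 'b) monoid_scheme \<Rightarrow> 'a set \<Rightarrow> 'a \<Rightarrow> 'a \<Rightarrow> real" where
  "word_dist G A x y = real (word_length G A (inv\<^bsub>G\<^esub> x \<otimes>\<^bsub>G\<^esub> y))"


section \<open>Ends\<close>

definition graph_components :: "'a set \<Rightarrow> ('a \<times> 'a) set \<Rightarrow> 'a set set" where
  "graph_components V E = V // ((E \<inter> V \<times> V)\<^sup>* \<inter> V \<times> V)"

definition enat_card :: "'a set \<Rightarrow> enat" where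
  "enat_card S = (if finite S then enat (card S) else \<infinity>)"

(* Intended for locally finite connected graphs, where a component is unbounded iff it is infinite. *)
definition number_of_ends :: "'a set \<Rightarrow> ('a \<times> 'a) set \<Rightarrow> enat" where
  "number_of_ends V E =
     (SUP F \<in> {F. finite F \<and> F \<subseteq> V}. enat_card {C \<in> graph_components (V - F) E. infinite C})"

definition cayley_edges :: "('a, 'b) monoid_scheme \<Rightarrow> 'a set \<Rightarrow> ('a \<times> 'a) set" where
  "cayley_edges G A = {(x, x \<otimes>\<^bsub>G\<^esub> a) | x a. x \<in> carrier G \<and> a \<in> A \<union> m_inv G ` A}"

(* The number of ends does not depend on the finite generating set. *)
definition one_ended :: "('a, 'b) monoid_scheme \<Rightarrow> bool" where
  "one_ended G \<longleftrightarrow>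
     (\<exists>A. finite_generating_set G A \<and> number_of_ends (carrier G) (cayley_edges G A) = 1)"


section \<open>Free groups and finite presentations\<close>

(* The letter (x, True) stands for x, the letter (x, False) for its inverse. *)
type_synonym 'x letter = "'x \<times> bool"

definition cancels :: "'x letter \<Rightarrow> 'x letter \<Rightarrow> bool" where
  "cancels p q \<longleftrightarrow> fst p = fst q \<and> snd p \<noteq> snd q"

fun push_letter :: "'x letter \<Rightarrow> 'x letter list \<Rightarrow> 'x letter list" where
  "push_letter p [] = [p]"
| "push_letter p (q # w) = (if cancels p q then w else p # q # w)"

(* Reduced words, multiplied by concatenation followed by free reduction. *)
definition free_group :: "'x set \<Rightarrow> 'x letter list monoid" where
  "free_group X =
     \<lparr>carrier = {w \<in> lists (X \<times> UNIV). successively (\<lambda>p q. \<not> cancels p q) w},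
      mult = foldr push_letter,
      one = []\<rparr>"

definition normal_closure :: "('a, 'b) monoid_scheme \<Rightarrow> 'a set \<Rightarrow> 'a set" where
  "normal_closure G R = \<Inter>{N. N \<lhd> G \<and> R \<subseteq> N}"

(* No generality is lost by taking the finitely many abstract generators to be natural numbers. *)
definition finitely_presented :: "('a, 'b) monoid_scheme \<Rightarrow> bool" where
  "finitely_presented G \<longleftrightarrow>
     (\<exists>(X :: nat set) R. finite X \<and> finite R \<and> R \<subseteq> carrier (free_group X) \<and>
        G \<cong> free_group X Mod normal_closure (free_group X) R)"


section \<open>Halos of groups and halo products\<close>

(* The group G is L(X); the groups L(S) are given as subgroups of it.  Values of L on sets that
   are not contained in X are irrelevant. *)
locale halo_of_groups = group G for G :: "'g monoid" and X :: "'x set" and L :: "'x set \<Rightarrow> 'g set" +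
  assumes halo_subgroup: "S \<subseteq> X \<Longrightarrow> subgroup (L S) G"
    and halo_top: "L X = carrier G"
    and halo_mono: "R \<subseteq> S \<Longrightarrow> S \<subseteq> X \<Longrightarrow> L R \<subseteq> L S"
    and halo_empty: "L {} = {\<one>\<^bsub>G\<^esub>}"
    and halo_generated: "carrier G = generate G (\<Union>S \<in> {S. S \<subseteq> X \<and> finite S}. L S)"
    and halo_Int: "R \<subseteq> X \<Longrightarrow> S \<subseteq> X \<Longrightarrow> L R \<inter> L S = L (R \<inter> S)"

locale halo_product_data = H: group H + halo_of_groups G "carrier H" L
  for H :: "'h monoid" and G :: "'g monoid" and L :: "'h set \<Rightarrow> 'g set" +
  fixes \<alpha> :: "'h \<Rightarrow> 'g \<Rightarrow> 'g"
  assumes action_hom: "\<alpha> \<in> hom H (AutoGroup G)"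
    and action_halo: "h \<in> carrier H \<Longrightarrow> S \<subseteq> carrier H \<Longrightarrow> \<alpha> h ` L S = L (h <#\<^bsub>H\<^esub> S)"

definition semidirect_product :: "'g monoid \<Rightarrow> 'h monoid \<Rightarrow> ('h \<Rightarrow> 'g \<Rightarrow> 'g) \<Rightarrow> ('g \<times> 'h) monoid" where
  "semidirect_product G H \<alpha> =
     \<lparr>carrier = carrier G \<times> carrier H,
      mult = (\<lambda>(a, h) (b, k). (a \<otimes>\<^bsub>G\<^esub> \<alpha> h b, h \<otimes>\<^bsub>H\<^esub> k)),
      one = (\<one>\<^bsub>G\<^esub>, \<one>\<^bsub>H\<^esub>)\<rparr>"

(* The distance to the empty set is infinite.  Fullness does not depend on this convention: K may
   always be enlarged, and for K > 0 the inclusion below is automatic if R, S, T or U is empty. *)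
definition set_dist :: "('x \<Rightarrow> 'x \<Rightarrow> real) \<Rightarrow> 'x set \<Rightarrow> 'x set \<Rightarrow> ereal" where
  "set_dist d R S = (INF r \<in> R. INF s \<in> S. ereal (d r s))"

definition full_halo ::
  "'g monoid \<Rightarrow> 'x set \<Rightarrow> ('x \<Rightarrow> 'x \<Rightarrow> real) \<Rightarrow> ('x set \<Rightarrow> 'g set) \<Rightarrow> bool" where
  "full_halo G X d L \<longleftrightarrow>
     (\<exists>K::real \<ge> 0. \<forall>R S T U. R \<subseteq> X \<and> S \<subseteq> X \<and> T \<subseteq> X \<and> U \<subseteq> X \<and>
        set_dist d R S \<ge> K \<and> set_dist d R T \<ge> K \<and> set_dist d R U \<ge> K \<and> set_dist d S T \<ge> K \<longrightarrow>
        (L (R \<union> S) <#>\<^bsub>G\<^esub> L U) \<inter> L (R \<union> T) \<subseteq> L R <#>\<^bsub>G\<^esub> L T)"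

end

theory Submission
  imports Defs
begin

text \<open>
  Write the elements of a halo product as pairs \<open>(a, h)\<close>, where \<open>a \<in> L(H)\<close> is a configuration and
  \<open>h \<in> H\<close> is the position of an arrow.  Multiplying on the right by a fixed element moves the arrow by a
  bounded amount and changes the configuration only near the arrow.  A subgroup \<open>K\<close> is conjugate
  into \<open>H\<close> as soon as \<open>K\<close> fixes a configuration \<open>c\<close>, that is, \<open>a \<cdot> h(c) = c\<close> for all \<open>(a, h) \<in> K\<close>.  If
  \<open>K\<close> is one-ended and finitely presented, then such a \<open>c\<close> is the configuration that is seen at
  infinity in \<open>K\<close>.

  To define it, take a finite set \<open>Q \<subseteq> H\<close> and consider the elements of \<open>K\<close> whose arrow is near \<open>Q\<close>.
  There may be infinitely many of them, because \<open>K\<close> may meet \<open>L(H)\<close>, but each component of this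
  preimage in the Cayley graph of \<open>K\<close> is finite: along it the configuration stays in a coset of a
  finitely generated, hence finite, subgroup of \<open>L(H)\<close> (\<open>finite_components_K\<close>).  As \<open>K\<close> is one-ended,
  each component has a finite filling, consisting of itself and of the finite components of its
  complement.  Two elements of \<open>K\<close> that lie in none of these fillings are joined by a path whose arrow
  avoids \<open>Q\<close> altogether (\<open>outside_linked\<close>): whenever a path runs through a component \<open>E\<close>, it can be led
  along the boundary of \<open>E\<close> instead, and this boundary is coarsely connected because \<open>K\<close> is finitely
  presented (\<open>coarsely_connected_boundaries\<close>).  Hence the configurations of all elements outside \<open>Q\<close>
  agree on \<open>Q\<close> (\<open>outside_agree\<close>).

  Up to translation there are only finitely many pairs of a translate of \<open>Q\<close> and a component, so the
  identity of \<open>K\<close> is outside all but finitely many translates of \<open>Q\<close> (\<open>finite_not_outside\<close>).  For single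
  points this says that the configuration at infinity is trivial at all but finitely many points of
  \<open>H\<close>.  Fullness glues these local data to an element \<open>c\<close> of \<open>L(H)\<close> (\<open>configuration_at_infinity\<close>).
  Everything is equivariant and the intersection of the \<open>L(H - {p})\<close> is trivial, so \<open>K\<close> fixes \<open>c\<close>
  (\<open>configuration_at_infinity_fixed\<close>).
\<close>

section \<open>Components of complements in graphs\<close>

definition linked :: "('a \<times> 'a) set \<Rightarrow> 'a set \<Rightarrow> ('a \<times> 'a) set" where
  "linked r V = (r \<inter> V \<times> V)\<^sup>*"

text \<open>For infinite connected locally finite graphs with one end and finite \<open>E\<close> this is
  \<open>E\<close> together with all the holes of its complement.  The points of \<open>E\<close> themselves qualify
  because a vertex outside \<open>V\<close> is linked in \<open>V\<close> to itself only.\<close>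

definition filling :: "('a \<times> 'a) set \<Rightarrow> 'a set \<Rightarrow> 'a set \<Rightarrow> 'a set" where
  "filling r X E = {x \<in> X. finite (linked r (X - E) `` {x})}"

lemma linked_refl [simp]: "(x, x) \<in> linked r V"
  by (simp add: linked_def)

lemma linked_trans: "(x, y) \<in> linked r V \<Longrightarrow> (y, z) \<in> linked r V \<Longrightarrow> (x, z) \<in> linked r V"
  unfolding linked_def by (rule rtrancl_trans)

lemma linked_sym: "sym r \<Longrightarrow> (x, y) \<in> linked r V \<Longrightarrow> (y, x) \<in> linked r V"
  unfolding linked_def
  by (rule symD[OF sym_rtrancl]) (auto simp: sym_def)

lemma linked_step: "(x, y) \<in> r \<Longrightarrow> x \<in> V \<Longrightarrow> y \<in> V \<Longrightarrow> (x, y) \<in> linked r V"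
  unfolding linked_def by auto

lemma linked_mono: "V \<subseteq> W \<Longrightarrow> (x, y) \<in> linked r V \<Longrightarrow> (x, y) \<in> linked r W"
  unfolding linked_def by (rule rtrancl_mono[THEN subsetD]) auto

lemma linked_induct [consumes 1, case_names refl step]:
  assumes "(x, y) \<in> linked r V" "P x"
    "\<And>y z. (x, y) \<in> linked r V \<Longrightarrow> y \<in> V \<Longrightarrow> z \<in> V \<Longrightarrow> (y, z) \<in> r \<Longrightarrow> P y \<Longrightarrow> P z"
  shows "P y"
  using assms(1) unfolding linked_def
  by (induction rule: rtrancl_induct) (use assms(2,3) in \<open>auto simp: linked_def\<close>)

lemma linked_cases: "(x, y) \<in> linked r V \<Longrightarrow> x = y \<or> x \<in> V \<and> y \<in> V"
  by (induction rule: linked_induct) auto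

lemma linked_mem: "(x, y) \<in> linked r V \<Longrightarrow> x \<in> V \<Longrightarrow> y \<in> V"
  using linked_cases[of x y r V] by auto

lemma linked_component_eq:
  "sym r \<Longrightarrow> (x, y) \<in> linked r V \<Longrightarrow> linked r V `` {x} = linked r V `` {y}"
  using linked_sym[of r x y V] linked_trans[of x y r V] linked_trans[of y x r V] by auto

lemma linked_in_component:
  assumes "(x, y) \<in> linked r V"
  shows "(x, y) \<in> linked r (linked r V `` {x})"
  using assms
proof (induction rule: linked_induct)
  case (step y z)
  have "(x, z) \<in> linked r V"
    using step linked_trans[OF step(1) linked_step] by auto
  then have "(y, z) \<in> linked r (linked r V `` {x})"
    using step by (intro linked_step) auto
  with step show ?case using linked_trans by fast
qed simp

lemma linked_constant:
  assumes "(x, y) \<in> linked r V" "\<And>u v. (u, v) \<in> r \<Longrightarrow> u \<in> V \<Longrightarrow> v \<in> V \<Longrightarrow> P u \<Longrightarrow> P v" "P x"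
  shows "P y"
  using assms by (induction rule: linked_induct) auto

lemma linked_until_entering:
  assumes "(x, e) \<in> linked r X" "e \<in> E" "x \<in> X - E"
  shows "\<exists>z z'. (x, z) \<in> linked r (X - E) \<and> z \<in> X - E \<and> z' \<in> E \<and> (z, z') \<in> r"
proof -
  have "(x, e) \<in> linked r (X - E) \<or> ?thesis"
    using assms(1)
  proof (induction rule: linked_induct)
    case (step y z)
    show ?case
    proof (cases "(x, y) \<in> linked r (X - E)")
      case True
      then have "y \<in> X - E" using assms(3) by (rule linked_mem)
      then show ?thesis
        using True step linked_trans[OF True linked_step[of y z r "X - E"]]
        by (cases "z \<in> E") auto
    qed (use step in auto)
  qed simp
  moreover have "(x, e) \<notin> linked r (X - E)"
    using assms(2,3) linked_mem[of x e r "X - E"] by auto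
  ultimately show ?thesis by auto
qed

lemma sym_relpow: "sym r \<Longrightarrow> (x, y) \<in> r ^^ n \<Longrightarrow> (y, x) \<in> r ^^ n"
proof (induction n arbitrary: y)
  case (Suc n)
  then obtain z where z: "(x, z) \<in> r ^^ n" "(z, y) \<in> r" by auto
  then have "(y, z) \<in> r" using Suc.prems(1) by (auto dest: symD)
  then show ?case using Suc.IH[OF Suc.prems(1) z(1)] by (rule relpow_Suc_I2)
qed simp

lemma linked_if_relpow:
  assumes "(x, y) \<in> r ^^ n" "\<And>z i. i \<le> n \<Longrightarrow> (x, z) \<in> r ^^ i \<Longrightarrow> z \<in> V"
  shows "(x, y) \<in> linked r V"
  using assms
proof (induction n arbitrary: y)
  case (Suc n)
  then obtain z where z: "(x, z) \<in> r ^^ n" "(z, y) \<in> r" by auto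
  have "(x, z) \<in> linked r V"
    by (rule Suc.IH[OF z(1)]) (rule Suc.prems(2)[OF le_SucI])
  moreover have "z \<in> V" "y \<in> V"
    using Suc.prems(2)[of n z] Suc.prems(2)[of "Suc n" y] Suc.prems(1) z by auto
  ultimately show ?case using linked_trans linked_step[OF z(2)] by metis
qed simp

text \<open>Paths as lists of vertices, where a vertex may be repeated so that paths with a common end point
  are composed by appending the lists.\<close>

definition path :: "('a \<times> 'a) set \<Rightarrow> 'a set \<Rightarrow> 'a list \<Rightarrow> bool" where
  "path r V xs \<longleftrightarrow> xs \<noteq> [] \<and> set xs \<subseteq> V \<and> successively (\<lambda>x y. (x, y) \<in> r\<^sup>=) xs"

lemma path_linked: "path r V xs \<Longrightarrow> (hd xs, last xs) \<in> linked r V"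
proof (induction xs)
  case (Cons x xs)
  show ?case
  proof (cases xs)
    case (Cons y ys)
    with Cons.prems have "(x, y) \<in> linked r V" "path r V xs"
      by (auto simp: path_def intro: linked_step)
    then show ?thesis using Cons.IH Cons linked_trans by auto
  qed simp
qed (simp add: path_def)

lemma linked_path:
  assumes "(x, y) \<in> linked r V" "x \<in> V"
  shows "\<exists>xs. path r V xs \<and> hd xs = x \<and> last xs = y"
  using assms(1)
proof (induction rule: linked_induct)
  case refl
  show ?case using assms(2) by (intro exI[of _ "[x]"]) (simp add: path_def)
next
  case (step y z)
  then obtain xs where "path r V xs" "hd xs = x" "last xs = y" by auto
  then show ?case using step
    by (intro exI[of _ "xs @ [z]"]) (auto simp: path_def successively_append_iff)
qed

lemma path_append:
  "path r V xs \<Longrightarrow> path r V ys \<Longrightarrow> (last xs, hd ys) \<in> r\<^sup>= \<Longrightarrow> path r V (xs @ ys)"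
  unfolding path_def by (auto simp: successively_append_iff)

lemma path_appendD:
  assumes "path r V (xs @ ys)" "xs \<noteq> []" "ys \<noteq> []"
  shows "path r V xs" "path r V ys" "(last xs, hd ys) \<in> r\<^sup>="
  using assms unfolding path_def by (auto simp: successively_append_iff)

lemma filling_mono: "E \<subseteq> E' \<Longrightarrow> filling r X E \<subseteq> filling r X E'"
  unfolding filling_def
  by (auto elim!: rev_finite_subset intro: linked_mono[of "X - E'" "X - E"])

lemma subset_filling:
  assumes "E \<subseteq> X" shows "E \<subseteq> filling r X E"
proof
  fix x assume x: "x \<in> E"
  have "linked r (X - E) `` {x} \<subseteq> {x}"
    using linked_cases[of x _ r "X - E"] x by auto
  then show "x \<in> filling r X E"
    using x assms finite_subset unfolding filling_def by blast
qed

locale connected_graph =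
  fixes X :: "'a set" and r :: "('a \<times> 'a) set"
  assumes edges: "r \<subseteq> X \<times> X" and sym_edges: "sym r"
    and finite_degree: "\<And>x. finite (r `` {x})"
    and connected: "\<And>x y. x \<in> X \<Longrightarrow> y \<in> X \<Longrightarrow> (x, y) \<in> linked r X"
begin

text \<open>Each component of the complement of \<open>E\<close> contains a neighbour of \<open>E\<close>, so there are only
  finitely many of them.\<close>

lemma finite_filling:
  assumes "finite E" "E \<noteq> {}" "E \<subseteq> X"
  shows "finite (filling r X E)"
proof -
  let ?comp = "\<lambda>z. linked r (X - E) `` {z}"
  have "filling r X E \<subseteq> E \<union> (\<Union>z \<in> {z \<in> r `` E. finite (?comp z)}. ?comp z)"
  proof
    fix x assume x: "x \<in> filling r X E"
    obtain e where e: "e \<in> E" using assms by auto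
    show "x \<in> E \<union> (\<Union>z \<in> {z \<in> r `` E. finite (?comp z)}. ?comp z)"
    proof (cases "x \<in> E")
      case False
      then obtain z z' where z: "(x, z) \<in> linked r (X - E)" "z' \<in> E" "(z, z') \<in> r"
        using linked_until_entering[OF connected[of x e] e] x e assms(3)
        unfolding filling_def by blast
      have "?comp z = ?comp x"
        using linked_component_eq[OF sym_edges z(1)] by simp
      then have "finite (?comp z)" "x \<in> ?comp z" using x by (auto simp: filling_def)
      moreover have "z \<in> r `` E" using z sym_edges by (auto dest: symD)
      ultimately show ?thesis by blast
    qed simp
  qed
  moreover have "finite (r `` E)"
    by (subst Image_eq_UN) (use assms(1) finite_degree in blast)
  then have "finite (E \<union> (\<Union>z \<in> {z \<in> r `` E. finite (?comp z)}. ?comp z))"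
    using assms(1) by simp
  ultimately show ?thesis by (rule finite_subset)
qed

lemma finite_relpow: "finite ((r ^^ n) `` {x})"
proof (induction n)
  case (Suc n)
  have "(r ^^ Suc n) `` {x} = (\<Union>y \<in> (r ^^ n) `` {x}. r `` {y})" by auto
  then show ?case using Suc finite_degree by simp
qed auto

end

section \<open>Cayley graphs and one-ended groups\<close>

context group
begin

lemma in_cayley_edges:
  "(x, y) \<in> cayley_edges G S \<longleftrightarrow> x \<in> carrier G \<and> (\<exists>s \<in> S \<union> m_inv G ` S. y = x \<otimes> s)"
  unfolding cayley_edges_def by auto

lemma cayley_edges_left_mult:
  assumes "S \<subseteq> carrier G" "k \<in> carrier G" "(x, y) \<in> cayley_edges G S"
  shows "(k \<otimes> x, k \<otimes> y) \<in> cayley_edges G S"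
proof -
  obtain s where "x \<in> carrier G" "s \<in> S \<union> m_inv G ` S" "y = x \<otimes> s"
    using assms(3) unfolding in_cayley_edges by auto
  moreover have "s \<in> carrier G" using calculation assms(1) by auto
  moreover have "k \<otimes> y = k \<otimes> x \<otimes> s" using calculation assms(2) by (simp add: m_assoc)
  ultimately show ?thesis unfolding in_cayley_edges using assms(2) by blast
qed

lemma linked_left_mult:
  assumes "S \<subseteq> carrier G" "k \<in> carrier G" "(x, y) \<in> linked (cayley_edges G S) V"
  shows "(k \<otimes> x, k \<otimes> y) \<in> linked (cayley_edges G S) ((\<otimes>) k ` V)"
  using assms(3)
proof (induction rule: linked_induct)
  case (step y z)
  then show ?case
    using linked_trans[OF step.IH linked_step] cayley_edges_left_mult[OF assms(1,2)] by blast
qed simp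

lemma left_mult_image_inv:
  assumes "k \<in> carrier G" "V \<subseteq> carrier G"
  shows "(\<otimes>) (inv k) ` (\<otimes>) k ` V = V"
proof -
  have "inv k \<otimes> (k \<otimes> v) = v" if "v \<in> V" for v
    using that assms by (metis inv_solve_left' m_closed subsetD)
  then show ?thesis by (force simp: image_image)
qed

lemma component_left_mult:
  assumes "S \<subseteq> carrier G" "k \<in> carrier G" "V \<subseteq> carrier G" "x \<in> carrier G"
  shows "linked (cayley_edges G S) ((\<otimes>) k ` V) `` {k \<otimes> x}
    = (\<otimes>) k ` (linked (cayley_edges G S) V `` {x})" (is "?l = ?r")
proof
  show "?r \<subseteq> ?l" using linked_left_mult[OF assms(1,2)] by auto
  show "?l \<subseteq> ?r"
  proof
    fix y assume "y \<in> ?l"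
    then have y: "(k \<otimes> x, y) \<in> linked (cayley_edges G S) ((\<otimes>) k ` V)" by simp
    have yc: "y \<in> carrier G" using linked_cases[OF y] assms by auto
    have "(inv k \<otimes> (k \<otimes> x), inv k \<otimes> y) \<in> linked (cayley_edges G S) V"
      using linked_left_mult[OF assms(1) inv_closed[OF assms(2)] y]
      unfolding left_mult_image_inv[OF assms(2,3)] .
    then have "(x, inv k \<otimes> y) \<in> linked (cayley_edges G S) V"
      using assms by (simp add: m_assoc[symmetric])
    moreover have "y = k \<otimes> (inv k \<otimes> y)" using assms yc by (simp add: m_assoc[symmetric])
    ultimately show "y \<in> ?r" by blast
  qed
qed

lemma inj_left_mult: "k \<in> carrier G \<Longrightarrow> V \<subseteq> carrier G \<Longrightarrow> inj_on ((\<otimes>) k) V"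
  by (rule inj_onI) (auto simp: subset_iff)

lemma filling_left_mult:
  assumes "S \<subseteq> carrier G" "k \<in> carrier G" "E \<subseteq> carrier G" "x \<in> carrier G"
  shows "k \<otimes> x \<in> filling (cayley_edges G S) (carrier G) ((\<otimes>) k ` E)
    \<longleftrightarrow> x \<in> filling (cayley_edges G S) (carrier G) E"
proof -
  have "(\<otimes>) k ` carrier G = carrier G"
  proof
    show "carrier G \<subseteq> (\<otimes>) k ` carrier G"
    proof
      fix y assume "y \<in> carrier G"
      then have "y = k \<otimes> (inv k \<otimes> y)" "inv k \<otimes> y \<in> carrier G"
        using assms(2) by (auto simp: m_assoc[symmetric])
      then show "y \<in> (\<otimes>) k ` carrier G" by blast
    qed
  qed (use assms in auto)
  then have "carrier G - (\<otimes>) k ` E = (\<otimes>) k ` (carrier G - E)"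
    using inj_on_image_set_diff[OF inj_left_mult[OF assms(2) subset_refl], of "carrier G" E] assms(3)
    by auto
  moreover have "linked (cayley_edges G S) ((\<otimes>) k ` (carrier G - E)) `` {k \<otimes> x}
    = (\<otimes>) k ` (linked (cayley_edges G S) (carrier G - E) `` {x})"
    using assms by (intro component_left_mult) auto
  moreover have "linked (cayley_edges G S) (carrier G - E) `` {x} \<subseteq> carrier G"
    using linked_cases[of x _ "cayley_edges G S" "carrier G - E"] assms(4) by fastforce
  ultimately show ?thesis
    using assms finite_image_iff[OF inj_left_mult] unfolding filling_def by auto
qed

lemma sym_cayley_edges:
  assumes "S \<subseteq> carrier G" shows "sym (cayley_edges G S)"
proof (rule symI)
  fix x y assume "(x, y) \<in> cayley_edges G S"
  then obtain s where s: "x \<in> carrier G" "s \<in> S \<union> m_inv G ` S" "y = x \<otimes> s"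
    unfolding in_cayley_edges by auto
  have "s \<in> carrier G" "inv s \<in> S \<union> m_inv G ` S" using s(2) assms by auto
  moreover have "x = y \<otimes> inv s" using s calculation by (simp add: m_assoc)
  ultimately show "(y, x) \<in> cayley_edges G S" unfolding in_cayley_edges using s by auto
qed

lemma connected_graph_cayley:
  assumes "finite_generating_set G S"
  shows "connected_graph (carrier G) (cayley_edges G S)"
proof
  have S: "finite S" "S \<subseteq> carrier G" "generate G S = carrier G"
    using assms unfolding finite_generating_set_def by auto
  show sym: "sym (cayley_edges G S)" by (rule sym_cayley_edges[OF S(2)])
  show edges: "cayley_edges G S \<subseteq> carrier G \<times> carrier G"
    unfolding cayley_edges_def using S by auto
  show "finite (cayley_edges G S `` {x})" for x
  proof -
    have "cayley_edges G S `` {x} \<subseteq> (\<lambda>s. x \<otimes> s) ` (S \<union> m_inv G ` S)"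
      unfolding in_cayley_edges Image_def by auto
    then show ?thesis by (rule finite_subset) (use S(1) in simp)
  qed
  have gen: "\<forall>x \<in> carrier G. (x, x \<otimes> g) \<in> linked (cayley_edges G S) (carrier G)"
    if "g \<in> generate G S" for g
    using that
  proof (induction rule: generate.induct)
    case (incl h)
    then show ?case using S(2) by (auto simp: in_cayley_edges intro!: linked_step)
  next
    case (inv h)
    show ?case
    proof
      fix x assume x: "x \<in> carrier G"
      have "(x, x \<otimes> inv h) \<in> cayley_edges G S" unfolding in_cayley_edges using x inv by blast
      then show "(x, x \<otimes> inv h) \<in> linked (cayley_edges G S) (carrier G)"
        by (rule linked_step) (use x inv S(2) in auto)
    qed
  next
    case (eng h1 h2)
    have h: "h1 \<in> carrier G" "h2 \<in> carrier G" using eng S by auto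
    show ?case
    proof
      fix x assume x: "x \<in> carrier G"
      then have "(x, x \<otimes> h1 \<otimes> h2) \<in> linked (cayley_edges G S) (carrier G)"
        using eng h linked_trans by (metis m_closed)
      then show "(x, x \<otimes> (h1 \<otimes> h2)) \<in> linked (cayley_edges G S) (carrier G)"
        using h x by (simp add: m_assoc)
    qed
  qed auto
  show "(x, y) \<in> linked (cayley_edges G S) (carrier G)" if "x \<in> carrier G" "y \<in> carrier G" for x y
  proof -
    have "(x, x \<otimes> (inv x \<otimes> y)) \<in> linked (cayley_edges G S) (carrier G)"
      using gen[of "inv x \<otimes> y"] that S(3) by auto
    then show ?thesis using that by (simp add: m_assoc[symmetric])
  qed
qed

lemma finite_right_mult_vimage:
  assumes "finite Y" "a \<in> carrier G"
  shows "finite {z \<in> carrier G. z \<otimes> a \<in> Y}"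
proof (rule inj_on_finite[of "\<lambda>z. z \<otimes> a" _ Y])
  show "inj_on (\<lambda>z. z \<otimes> a) {z \<in> carrier G. z \<otimes> a \<in> Y}"
    by (rule inj_onI) (use assms in auto)
qed (use assms in auto)

lemma infinite_components_unique:
  assumes "number_of_ends V r = 1" "sym r" "finite F" "F \<subseteq> V" "x \<in> V - F" "y \<in> V - F"
    "infinite (linked r (V - F) `` {x})" "infinite (linked r (V - F) `` {y})"
  shows "(x, y) \<in> linked r (V - F)"
proof -
  let ?W = "V - F"
  let ?comp = "\<lambda>x. linked r ?W `` {x}"
  have comp: "?comp z \<in> graph_components ?W r" if "z \<in> ?W" for z
  proof -
    have "?comp z = ((r \<inter> ?W \<times> ?W)\<^sup>* \<inter> ?W \<times> ?W) `` {z}"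
      using that linked_mem[of z _ r ?W] unfolding linked_def by auto
    then show ?thesis unfolding graph_components_def using that by (auto simp: quotient_def)
  qed
  let ?I = "{C \<in> graph_components ?W r. infinite C}"
  have "enat_card ?I \<le> 1"
    unfolding assms(1)[symmetric] number_of_ends_def using assms(3,4) by (intro SUP_upper) auto
  then have I: "finite ?I" "card ?I \<le> 1"
    unfolding enat_card_def one_enat_def by (auto split: if_splits)
  have unique: "C = D" if "C \<in> ?I" "D \<in> ?I" for C D
    by (rule card_le_Suc0_iff_eq[OF I(1), THEN iffD1, rule_format, OF _ that]) (use I(2) in simp)
  have "?comp x = ?comp y"
    by (rule unique) (use comp[OF assms(5)] comp[OF assms(6)] assms(7,8) in simp_all)
  moreover have "y \<in> ?comp y" by simp
  ultimately show ?thesis by (metis (lifting) Image_singleton_iff)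
qed

lemma one_ended_infinite:
  assumes "one_ended G" shows "infinite (carrier G)"
proof
  assume fin: "finite (carrier G)"
  obtain S where S: "number_of_ends (carrier G) (cayley_edges G S) = 1"
    using assms unfolding one_ended_def by auto
  have empty: "{C \<in> graph_components (carrier G - F) (cayley_edges G S). infinite C} = {}" for F
  proof -
    have "finite C" if "C \<in> graph_components (carrier G - F) (cayley_edges G S)" for C
    proof (rule finite_subset[OF _ fin])
      show "C \<subseteq> carrier G" using that unfolding graph_components_def quotient_def by auto
    qed
    then show ?thesis by blast
  qed
  have "number_of_ends (carrier G) (cayley_edges G S) \<le> 0"
    unfolding number_of_ends_def empty by (intro SUP_least) (simp add: enat_card_def zero_enat_def)
  then show False using S by simp
qed

text \<open>Independence of the generating set comes from a description of one-endedness by subsets that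
  are almost invariant under right translations.  If such a set and its complement were both
  infinite, then, after removing the finite coboundary, each would contain an infinite component.\<close>

lemma almost_invariant_finite_or_cofinite:
  assumes "one_ended G" "Y \<subseteq> carrier G"
    and inv: "\<And>a. a \<in> carrier G \<Longrightarrow> finite {x \<in> Y. x \<otimes> a \<notin> Y}"
  shows "finite Y \<or> finite (carrier G - Y)"
proof (rule ccontr)
  assume inf: "\<not> ?thesis"
  obtain S where S: "finite_generating_set G S" "number_of_ends (carrier G) (cayley_edges G S) = 1"
    using assms unfolding one_ended_def by auto
  let ?r = "cayley_edges G S"
  interpret connected_graph "carrier G" ?r by (rule connected_graph_cayley[OF S(1)])
  have Sc: "finite S" "S \<subseteq> carrier G" using S unfolding finite_generating_set_def by auto
  let ?S = "S \<union> m_inv G ` S"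
  define F where "F = insert \<one> (\<Union>a \<in> ?S. {x \<in> Y. x \<otimes> a \<notin> Y} \<union> {x \<in> carrier G - Y. x \<otimes> a \<in> Y})"
  have fin: "finite ({x \<in> Y. x \<otimes> a \<notin> Y} \<union> {x \<in> carrier G - Y. x \<otimes> a \<in> Y})" if "a \<in> ?S" for a
  proof -
    have a: "a \<in> carrier G" using that Sc by auto
    have "{x \<in> carrier G - Y. x \<otimes> a \<in> Y}
      \<subseteq> {x \<in> carrier G. x \<otimes> a \<in> {y \<in> Y. y \<otimes> inv a \<notin> Y}}"
      using a by (auto simp: m_assoc)
    then have "finite {x \<in> carrier G - Y. x \<otimes> a \<in> Y}"
      using finite_right_mult_vimage[OF inv[OF inv_closed[OF a]] a] finite_subset by blast
    then show ?thesis using inv[OF a] by simp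
  qed
  have F: "finite F" "F \<noteq> {}" "F \<subseteq> carrier G"
    unfolding F_def using fin Sc assms(2) by auto
  have hull: "finite (filling ?r (carrier G) F)" by (rule finite_filling[OF F])
  obtain x where x: "x \<in> Y" "x \<notin> filling ?r (carrier G) F"
    using hull inf by (meson finite_subset subsetI)
  obtain y where y: "y \<in> carrier G - Y" "y \<notin> filling ?r (carrier G) F"
    using hull inf by (meson finite_subset subsetI)
  have "(x, y) \<in> linked ?r (carrier G - F)"
    using x y assms(2) subset_filling[OF F(3), of ?r]
    by (intro infinite_components_unique[OF S(2) sym_edges F(1,3)]) (auto simp: filling_def)
  then have "y \<in> Y"
  proof (rule linked_constant[of x y ?r "carrier G - F" "\<lambda>z. z \<in> Y"])
    fix u v assume "(u, v) \<in> ?r" "u \<in> carrier G - F" "v \<in> carrier G - F" "u \<in> Y"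
    then show "v \<in> Y" unfolding in_cayley_edges F_def by blast
  qed (rule x(1))
  then show False using y by simp
qed

text \<open>A component of the complement of a finite set is almost invariant, for the Cayley graph of any
  finite generating set.  So an infinite component is cofinite, and two of them meet.\<close>

lemma one_ended_linked:
  assumes "one_ended G" "finite_generating_set G S" "finite E" "E \<subseteq> carrier G"
    and x: "x \<in> carrier G - filling (cayley_edges G S) (carrier G) E"
    and y: "y \<in> carrier G - filling (cayley_edges G S) (carrier G) E"
  shows "(x, y) \<in> linked (cayley_edges G S) (carrier G - E)"
proof -
  let ?r = "cayley_edges G S"
  let ?comp = "\<lambda>x. linked ?r (carrier G - E) `` {x}"
  interpret connected_graph "carrier G" ?r by (rule connected_graph_cayley[OF assms(2)])
  have S: "S \<subseteq> carrier G" "generate G S = carrier G"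
    using assms(2) unfolding finite_generating_set_def by auto
  have cofinite: "finite (carrier G - ?comp z)" "?comp z \<subseteq> carrier G"
    if z: "z \<in> carrier G - filling ?r (carrier G) E" for z
  proof -
    let ?W = "?comp z"
    have W: "?W \<subseteq> carrier G - E"
      using z subset_filling[OF assms(4), of ?r] linked_mem[of z _ ?r "carrier G - E"] by blast
    then show WG: "?W \<subseteq> carrier G" by auto
    have gen: "finite {w \<in> ?W. w \<otimes> s \<notin> ?W}" if s: "s \<in> S \<union> m_inv G ` S" for s
    proof -
      have sc: "s \<in> carrier G" using s S by auto
      have "w \<otimes> s \<in> E" if w: "w \<in> ?W" "w \<otimes> s \<notin> ?W" for w
      proof (rule ccontr)
        assume "w \<otimes> s \<notin> E"
        then have "(w, w \<otimes> s) \<in> linked ?r (carrier G - E)"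
          using w W s sc by (intro linked_step) (auto simp: in_cayley_edges)
        then show False using w linked_trans by fastforce
      qed
      then have "{w \<in> ?W. w \<otimes> s \<notin> ?W} \<subseteq> {w \<in> carrier G. w \<otimes> s \<in> E}"
        using W by auto
      then show ?thesis using finite_right_mult_vimage[OF assms(3) sc] by (rule finite_subset)
    qed
    have "finite {w \<in> ?W. w \<otimes> a \<notin> ?W}" if a: "a \<in> generate G S" for a
      using a
    proof (induction rule: generate.induct)
      case one
      have "{w \<in> ?W. w \<otimes> \<one> \<notin> ?W} = {}" using WG by auto
      then show ?case by (simp only: finite.emptyI)
    next
      case (eng a b)
      have ab: "a \<in> carrier G" "b \<in> carrier G" using eng S by auto
      have "{w \<in> ?W. w \<otimes> (a \<otimes> b) \<notin> ?W}
        \<subseteq> {w \<in> ?W. w \<otimes> a \<notin> ?W} \<union> {w \<in> carrier G. w \<otimes> a \<in> {v \<in> ?W. v \<otimes> b \<notin> ?W}}"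
        using ab WG by (auto simp: m_assoc subset_iff)
      then show ?case
        using eng finite_right_mult_vimage[OF _ ab(1)] by (meson finite_UnI finite_subset)
    qed (use gen in auto)
    then have "finite ?W \<or> finite (carrier G - ?W)"
      using S WG by (intro almost_invariant_finite_or_cofinite[OF assms(1)]) auto
    then show "finite (carrier G - ?W)" using z by (auto simp: filling_def)
  qed
  have "?comp x \<inter> ?comp y \<noteq> {}"
  proof
    assume "?comp x \<inter> ?comp y = {}"
    then have "carrier G \<subseteq> (carrier G - ?comp x) \<union> (carrier G - ?comp y)" by auto
    then show False
      using cofinite(1)[OF x] cofinite(1)[OF y] one_ended_infinite[OF assms(1)]
      by (meson finite_UnI finite_subset)
  qed
  then obtain w where "(x, w) \<in> linked ?r (carrier G - E)" "(y, w) \<in> linked ?r (carrier G - E)"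
    by auto
  then show ?thesis using linked_sym[OF sym_edges] linked_trans by metis
qed

end

section \<open>Free groups and presentations\<close>

abbreviation reduced :: "'x letter list \<Rightarrow> bool" where
  "reduced \<equiv> successively (\<lambda>p q. \<not> cancels p q)"

definition inv_letter :: "'x letter \<Rightarrow> 'x letter" where
  "inv_letter p = (fst p, \<not> snd p)"

definition inv_word :: "'x letter list \<Rightarrow> 'x letter list" where
  "inv_word w = rev (map inv_letter w)"

lemma inv_letter_inv_letter [simp]: "inv_letter (inv_letter p) = p"
  by (simp add: inv_letter_def)

lemma cancels_iff: "cancels p q \<longleftrightarrow> q = inv_letter p"
  by (cases p; cases q) (auto simp: cancels_def inv_letter_def)

lemma inv_letter_mem [simp]: "inv_letter p \<in> X \<times> UNIV \<longleftrightarrow> p \<in> X \<times> UNIV"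
  by (cases p) (auto simp: inv_letter_def)

lemma inv_word_mem: "w \<in> lists (X \<times> UNIV) \<Longrightarrow> inv_word w \<in> lists (X \<times> UNIV)"
  unfolding inv_word_def in_lists_conv_set using inv_letter_mem by (auto simp del: mem_Sigma_iff)

lemma reduced_push_letter: "reduced w \<Longrightarrow> reduced (push_letter p w)"
  by (cases w; cases "tl w") auto

lemma push_letter_mem: "p \<in> A \<Longrightarrow> w \<in> lists A \<Longrightarrow> push_letter p w \<in> lists A"
  by (cases w) auto

lemma push_letter_inv_letter: "reduced w \<Longrightarrow> push_letter (inv_letter p) (push_letter p w) = w"
  by (cases w; cases "tl w") (auto simp: cancels_iff)

lemma push_letter_inv_letter': "reduced w \<Longrightarrow> push_letter p (push_letter (inv_letter p) w) = w"
  using push_letter_inv_letter[of w "inv_letter p"] by simp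

lemma reduced_foldr_push: "reduced c \<Longrightarrow> reduced (foldr push_letter w c)"
  by (induction w) (auto intro: reduced_push_letter)

lemma foldr_push_mem: "w \<in> lists A \<Longrightarrow> c \<in> lists A \<Longrightarrow> foldr push_letter w c \<in> lists A"
proof (induction w)
  case (Cons p w)
  then show ?case using push_letter_mem[of p A "foldr push_letter w c"] by simp
qed simp

text \<open>Pushing a letter permutes the reduced words, and the inverse letter pushes back.  Since a product
  is a composition of such permutations applied to a word, the multiplication of reduced words is
  associative.\<close>

lemma foldr_push_push:
  assumes "reduced c"
  shows "foldr push_letter (push_letter p w) c = push_letter p (foldr push_letter w c)"
proof (cases w)
  case (Cons q w')
  then show ?thesis
    using push_letter_inv_letter'[OF reduced_foldr_push[OF assms], of p w'] by (auto simp: cancels_iff)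
qed simp

lemma foldr_push_assoc:
  "reduced c \<Longrightarrow> foldr push_letter (foldr push_letter a b) c = foldr push_letter a (foldr push_letter b c)"
  by (induction a) (auto simp: foldr_push_push)

lemma foldr_push_Nil: "reduced w \<Longrightarrow> foldr push_letter w [] = w"
proof (induction w)
  case (Cons p w)
  then show ?case by (cases w) auto
qed simp

lemma foldr_push_inv_word:
  "reduced c \<Longrightarrow> foldr push_letter (inv_word w) (foldr push_letter w c) = c"
  unfolding inv_word_def
  by (induction w arbitrary: c) (auto simp: push_letter_inv_letter reduced_foldr_push)

lemma free_group_simps [simp]:
  "carrier (free_group X) = {w \<in> lists (X \<times> UNIV). reduced w}"
  "a \<otimes>\<^bsub>free_group X\<^esub> b = foldr push_letter a b"
  "\<one>\<^bsub>free_group X\<^esub> = []"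
  by (simp_all add: free_group_def)

lemma foldr_push_in_free_group:
  "w \<in> lists (X \<times> UNIV) \<Longrightarrow> foldr push_letter w [] \<in> carrier (free_group X)"
  using foldr_push_mem[of w "X \<times> UNIV" "[]"] reduced_foldr_push[of "[]" w] by simp

lemma group_free_group: "group (free_group X)"
proof (rule groupI)
  show "\<exists>b \<in> carrier (free_group X). b \<otimes>\<^bsub>free_group X\<^esub> a = \<one>\<^bsub>free_group X\<^esub>"
    if "a \<in> carrier (free_group X)" for a
  proof
    show "foldr push_letter (inv_word a) [] \<in> carrier (free_group X)"
      using that inv_word_mem by (intro foldr_push_in_free_group) auto
    have "foldr push_letter (inv_word a) (foldr push_letter a []) = []"
      by (rule foldr_push_inv_word) simp
    then show "foldr push_letter (inv_word a) [] \<otimes>\<^bsub>free_group X\<^esub> a = \<one>\<^bsub>free_group X\<^esub>"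
      using that foldr_push_assoc[of a "inv_word a" "[]"] by (simp add: foldr_push_Nil)
  qed
qed (auto simp: foldr_push_mem reduced_foldr_push foldr_push_assoc simp del: in_lists_conv_set)

lemma inv_free_group:
  "w \<in> carrier (free_group X) \<Longrightarrow> inv\<^bsub>free_group X\<^esub> w = foldr push_letter (inv_word w) []"
proof (rule group.inv_equality[OF group_free_group])
  assume w: "w \<in> carrier (free_group X)"
  show "foldr push_letter (inv_word w) [] \<in> carrier (free_group X)"
    using w inv_word_mem by (intro foldr_push_in_free_group) auto
  show "foldr push_letter (inv_word w) [] \<otimes>\<^bsub>free_group X\<^esub> w = \<one>\<^bsub>free_group X\<^esub>"
    using w foldr_push_assoc[of w "inv_word w" "[]"] foldr_push_inv_word[of "[]" w]
    by (simp add: foldr_push_Nil)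
qed

definition eval_word :: "('a, 'b) monoid_scheme \<Rightarrow> ('x letter \<Rightarrow> 'a) \<Rightarrow> 'x letter list \<Rightarrow> 'a" where
  "eval_word G v w = foldr (\<otimes>\<^bsub>G\<^esub>) (map v w) \<one>\<^bsub>G\<^esub>"

fun walk :: "('a, 'b) monoid_scheme \<Rightarrow> ('x letter \<Rightarrow> 'a) \<Rightarrow> 'a \<Rightarrow> 'x letter list \<Rightarrow> ('a \<times> 'x letter) list"
where
  "walk G v x [] = []"
| "walk G v x (l # w) = (x, l) # walk G v (x \<otimes>\<^bsub>G\<^esub> v l) w"

fun parity :: "('e \<Rightarrow> bool) \<Rightarrow> 'e list \<Rightarrow> bool" where
  "parity \<omega> [] = False"
| "parity \<omega> (e # es) = (\<omega> e \<noteq> parity \<omega> es)"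

lemma parity_append: "parity \<omega> (es @ es') = (parity \<omega> es \<noteq> parity \<omega> es')"
  by (induction es) auto

text \<open>That \<open>R\<close> generates the relations as a normal subgroup is stated as an induction principle: what
  holds on a normal subgroup that contains \<open>R\<close> holds for all words that evaluate to the identity.\<close>

locale presentation = group G for G :: "('a, 'b) monoid_scheme" (structure) +
  fixes X :: "'x set" and R :: "'x letter list set" and v :: "'x letter \<Rightarrow> 'a"
  assumes finite_X: "finite X" and finite_R: "finite R" and R_words: "R \<subseteq> carrier (free_group X)"
    and v_closed: "l \<in> X \<times> UNIV \<Longrightarrow> v l \<in> carrier G"
    and v_inv: "l \<in> X \<times> UNIV \<Longrightarrow> v (inv_letter l) = inv (v l)"
    and surjective: "g \<in> carrier G \<Longrightarrow> \<exists>w \<in> lists (X \<times> UNIV). g = eval_word G v w"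
    and relators: "w \<in> R \<Longrightarrow> eval_word G v w = \<one>"
    and kernel: "N \<lhd> free_group X \<Longrightarrow> R \<subseteq> N \<Longrightarrow> w \<in> carrier (free_group X) \<Longrightarrow>
      eval_word G v w = \<one> \<Longrightarrow> w \<in> N"

lemma finitely_presented_presentation:
  fixes G :: "('a, 'b) monoid_scheme"
  assumes "finitely_presented G" "group G"
  shows "\<exists>(X :: nat set) R v. presentation G X R v"
proof -
  interpret G: group G by (rule assms(2))
  obtain X :: "nat set" and R where X: "finite X" "finite R" "R \<subseteq> carrier (free_group X)"
    "G \<cong> free_group X Mod normal_closure (free_group X) R"
    using assms unfolding finitely_presented_def by auto
  let ?F = "free_group X"
  define N where "N = normal_closure ?F R"
  interpret F: group ?F by (rule group_free_group)
  have "carrier ?F \<lhd> ?F"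
    by (rule F.normal_inv_iff[THEN iffD2]) (simp add: F.subgroup_self del: free_group_simps)
  then have nonempty: "{N. N \<lhd> ?F \<and> R \<subseteq> N} \<noteq> {}" using X(3) by blast
  have "N \<lhd> ?F"
    unfolding N_def normal_closure_def
  proof (rule F.normal_inv_iff[THEN iffD2], intro conjI ballI)
    show "subgroup (\<Inter>{N. N \<lhd> ?F \<and> R \<subseteq> N}) ?F"
      by (rule F.subgroups_Inter[OF _ nonempty]) (auto simp: F.normal_inv_iff)
  qed (auto simp: F.normal_inv_iff simp del: free_group_simps)
  then interpret N: normal N ?F .
  have RN: "R \<subseteq> N" unfolding N_def normal_closure_def by auto
  interpret Q: group "?F Mod N" by (rule N.factorgroup_is_group)
  obtain \<phi> where \<phi>: "\<phi> \<in> iso G (?F Mod N)" using X(4) unfolding N_def is_iso_def by auto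
  define \<psi> where "\<psi> = inv_into (carrier G) \<phi>"
  have \<psi>: "\<psi> \<in> iso (?F Mod N) G" unfolding \<psi>_def by (rule G.iso_set_sym[OF \<phi>])
  define \<theta> where "\<theta> = (\<lambda>w. \<psi> (N #>\<^bsub>?F\<^esub> w))"
  have "\<psi> \<circ> (\<lambda>w. N #>\<^bsub>?F\<^esub> w) \<in> hom ?F G"
    using N.r_coset_hom_Mod \<psi> by (intro hom_compose[where H = "?F Mod N"]) (auto simp: iso_def)
  then have \<theta>: "\<theta> \<in> hom ?F G" by (simp add: \<theta>_def o_def)
  interpret \<theta>: group_hom ?F G \<theta> using \<theta> by unfold_locales
  define v where "v l = \<theta> (foldr push_letter [l] [])" for l
  have letter: "foldr push_letter [l] [] \<in> carrier ?F" if "l \<in> X \<times> UNIV" for l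
    using that by (intro foldr_push_in_free_group) auto
  have v: "v l \<in> carrier G" if "l \<in> X \<times> UNIV" for l
    unfolding v_def using letter[OF that] by (rule \<theta>.hom_closed)
  have ev: "eval_word G v w = \<theta> (foldr push_letter w [])" if "w \<in> lists (X \<times> UNIV)" for w
    using that
  proof (induction w)
    case Nil
    then show ?case using \<theta>.hom_one by (simp add: eval_word_def)
  next
    case (Cons l w)
    have "eval_word G v (l # w) = v l \<otimes>\<^bsub>G\<^esub> \<theta> (foldr push_letter w [])"
      using Cons by (simp add: eval_word_def)
    also have "\<dots> = \<theta> (foldr push_letter [l] [] \<otimes>\<^bsub>?F\<^esub> foldr push_letter w [])"
      unfolding v_def using Cons letter foldr_push_in_free_group
      by (intro \<theta>.hom_mult[symmetric]) auto
    finally show ?case by simp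
  qed
  have ev': "eval_word G v w = \<theta> w" if "w \<in> carrier ?F" for w
    using ev[of w] that foldr_push_Nil[of w] by auto
  have ker: "\<theta> w = \<one>\<^bsub>G\<^esub> \<longleftrightarrow> w \<in> N" if w: "w \<in> carrier ?F" for w
  proof -
    have "\<psi> N = \<one>\<^bsub>G\<^esub>"
      using \<psi> hom_one[of \<psi> "?F Mod N" G] Q.is_group G.is_group by (auto simp: iso_def FactGroup_def)
    moreover have "inj_on \<psi> (carrier (?F Mod N))" using \<psi> by (auto simp: iso_def bij_betw_def)
    moreover have "N #>\<^bsub>?F\<^esub> w \<in> carrier (?F Mod N)"
      using w unfolding FactGroup_def RCOSETS_def by auto
    moreover have "N \<in> carrier (?F Mod N)" using Q.one_closed by (simp add: FactGroup_def)
    ultimately have "\<theta> w = \<one>\<^bsub>G\<^esub> \<longleftrightarrow> N #>\<^bsub>?F\<^esub> w = N" unfolding \<theta>_def inj_on_def by metis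
    also have "\<dots> \<longleftrightarrow> w \<in> N"
      using F.coset_join1[OF _ w N.subgroup_axioms] F.coset_join2[OF w N.subgroup_axioms] N.subset by auto
    finally show ?thesis .
  qed
  have "presentation G X R v"
  proof
    show "finite X" "finite R" "R \<subseteq> carrier ?F" by (fact X)+
    show "v l \<in> carrier G" if "l \<in> X \<times> UNIV" for l by (rule v[OF that])
    show "v (inv_letter l) = inv\<^bsub>G\<^esub> v l" if l: "l \<in> X \<times> UNIV" for l
    proof (rule G.inv_equality[symmetric])
      have "v (inv_letter l) \<otimes>\<^bsub>G\<^esub> v l = eval_word G v [inv_letter l, l]"
        using v[OF l] by (simp add: eval_word_def)
      also have "\<dots> = \<theta> []" using l by (subst ev) (auto simp: cancels_iff simp del: mem_Sigma_iff)
      finally show "v (inv_letter l) \<otimes>\<^bsub>G\<^esub> v l = \<one>\<^bsub>G\<^esub>" using \<theta>.hom_one by simp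
    qed (use v l in \<open>auto simp del: mem_Sigma_iff\<close>)
    show "\<exists>w \<in> lists (X \<times> UNIV). g = eval_word G v w" if "g \<in> carrier G" for g
    proof -
      have "g \<in> \<psi> ` carrier (?F Mod N)" using that \<psi> by (auto simp: iso_def bij_betw_def)
      then obtain w where w: "w \<in> carrier ?F" "g = \<theta> w"
        unfolding FactGroup_def RCOSETS_def \<theta>_def by auto
      then have "w \<in> lists (X \<times> UNIV)" "g = eval_word G v w" using ev'[OF w(1)] by auto
      then show ?thesis by blast
    qed
    show "eval_word G v w = \<one>\<^bsub>G\<^esub>" if "w \<in> R" for w
    proof -
      have "w \<in> carrier ?F" "w \<in> N" using that X(3) RN by auto
      then show ?thesis using ev'[of w] ker[of w] by simp
    qed
    show "w \<in> M" if "M \<lhd> ?F" "R \<subseteq> M" "w \<in> carrier ?F" "eval_word G v w = \<one>\<^bsub>G\<^esub>" for M w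
    proof -
      have "w \<in> N" using that ev' ker by auto
      then show ?thesis using that unfolding N_def normal_closure_def by auto
    qed
  qed
  then show ?thesis by blast
qed

context presentation
begin

abbreviation ev :: "'x letter list \<Rightarrow> 'a" where
  "ev \<equiv> eval_word G v"

abbreviation letters :: "'x letter set" where
  "letters \<equiv> X \<times> UNIV"

lemma ev_Nil [simp]: "ev [] = \<one>"
  by (simp add: eval_word_def)

lemma ev_Cons [simp]: "ev (l # w) = v l \<otimes> ev w"
  by (simp add: eval_word_def)

lemma ev_closed [simp, intro]: "w \<in> lists letters \<Longrightarrow> ev w \<in> carrier G"
  by (induction w) (use v_closed in \<open>auto simp del: mem_Sigma_iff\<close>)

lemma ev_append: "w \<in> lists letters \<Longrightarrow> w' \<in> lists letters \<Longrightarrow> ev (w @ w') = ev w \<otimes> ev w'"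
proof (induction w)
  case (Cons l w)
  have "ev w \<in> carrier G" "ev w' \<in> carrier G" "v l \<in> carrier G"
    using Cons v_closed by auto
  then show ?case using Cons by (simp add: m_assoc del: mem_Sigma_iff)
qed simp

lemma ev_push_letter:
  assumes "l \<in> letters" "w \<in> lists letters"
  shows "ev (push_letter l w) = v l \<otimes> ev w"
proof (cases w)
  case (Cons q w')
  have "ev w' \<in> carrier G" "v l \<in> carrier G" using Cons assms v_closed by auto
  then show ?thesis
    using Cons v_inv[OF assms(1)] by (auto simp: cancels_iff m_assoc[symmetric])
qed simp

lemma ev_foldr_push:
  "w \<in> lists letters \<Longrightarrow> c \<in> lists letters \<Longrightarrow> ev (foldr push_letter w c) = ev w \<otimes> ev c"
proof (induction w)
  case (Cons l w)
  have "ev w \<in> carrier G" "ev c \<in> carrier G" "v l \<in> carrier G"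
    using Cons v_closed by auto
  then show ?case
    using Cons foldr_push_mem[of w letters c]
    by (simp add: ev_push_letter m_assoc del: mem_Sigma_iff in_lists_conv_set)
qed auto

lemma ev_inv_word:
  "w \<in> lists letters \<Longrightarrow> ev (inv_word w) = inv (ev w)"
proof (induction w)
  case (Cons l w)
  have "ev w \<in> carrier G" "v l \<in> carrier G" using Cons v_closed by auto
  moreover have "ev (inv_word (l # w)) = ev (inv_word w) \<otimes> v (inv_letter l)"
    using Cons ev_append[of "inv_word w" "[inv_letter l]"] inv_word_mem[of w X] v_closed[of "inv_letter l"]
    by (auto simp: inv_word_def simp del: mem_Sigma_iff)
  ultimately show ?case using Cons v_inv by (simp add: inv_mult_group del: mem_Sigma_iff)
qed (simp add: inv_word_def)

lemma walk_append:
  "x \<in> carrier G \<Longrightarrow> w \<in> lists letters \<Longrightarrow> walk G v x (w @ w') = walk G v x w @ walk G v (x \<otimes> ev w) w'"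
proof (induction w arbitrary: x)
  case (Cons l w)
  have "ev w \<in> carrier G" "v l \<in> carrier G" using Cons v_closed by auto
  then show ?case using Cons by (simp add: m_assoc del: mem_Sigma_iff)
qed simp

lemma walk_vertex:
  assumes "(z, l) \<in> set (walk G v x w)" "x \<in> carrier G" "w \<in> lists letters"
  shows "\<exists>w1 w2. w = w1 @ l # w2 \<and> z = x \<otimes> ev w1"
  using assms
proof (induction w arbitrary: x)
  case (Cons k w)
  show ?case
  proof (cases "(z, l) = (x, k)")
    case True
    then show ?thesis using Cons by (intro exI[of _ "[]"] exI[of _ w]) auto
  next
    case False
    have k: "v k \<in> carrier G" "x \<otimes> v k \<in> carrier G" using Cons v_closed by auto
    obtain w1 w2 where w: "w = w1 @ l # w2" "z = x \<otimes> v k \<otimes> ev w1"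
      using Cons.IH[OF _ k(2)] Cons.prems False by auto
    moreover have "ev w1 \<in> carrier G" using w Cons.prems by auto
    ultimately show ?thesis using k Cons.prems by (intro exI[of _ "k # w1"] exI[of _ w2]) (auto simp: m_assoc)
  qed
qed simp

lemma parity_telescope:
  fixes f :: "'a \<Rightarrow> bool"
  assumes "\<And>z l. (z, l) \<in> set (walk G v x w) \<Longrightarrow> \<omega> (z, l) = (f z \<noteq> f (z \<otimes> v l))"
    "x \<in> carrier G" "w \<in> lists letters"
  shows "parity \<omega> (walk G v x w) = (f x \<noteq> f (x \<otimes> ev w))"
  using assms
proof (induction w arbitrary: x)
  case (Cons l w)
  have c: "ev w \<in> carrier G" "v l \<in> carrier G" using Cons v_closed by auto
  have IH: "parity \<omega> (walk G v (x \<otimes> v l) w) = (f (x \<otimes> v l) \<noteq> f (x \<otimes> v l \<otimes> ev w))"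
    using Cons.prems c by (intro Cons.IH) auto
  have edge: "\<omega> (x, l) = (f x \<noteq> f (x \<otimes> v l))" using Cons.prems(1)[of x l] by simp
  have vertex: "x \<otimes> v l \<otimes> ev w = x \<otimes> ev (l # w)" using c Cons.prems by (simp add: m_assoc)
  show ?case unfolding walk.simps parity.simps IH edge vertex by blast
qed simp

lemma parity_zero:
  assumes "\<And>z l. (z, l) \<in> set (walk G v x w) \<Longrightarrow> \<not> \<omega> (z, l)" "x \<in> carrier G" "w \<in> lists letters"
  shows "\<not> parity \<omega> (walk G v x w)"
  using parity_telescope[of x w \<omega> "\<lambda>_. True"] assms by auto

text \<open>Presentations yield the following form of simple connectedness: a set \<open>\<omega>\<close> of unoriented
  edges that meets every relator loop an even number of times meets every loop an even number of
  times.  Indeed the parity is invariant under free reduction, and the reduced words along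
  which all parities vanish form a normal subgroup.\<close>

lemma parity_closed_walk:
  assumes sym: "\<And>z l. z \<in> carrier G \<Longrightarrow> l \<in> letters \<Longrightarrow> \<omega> (z \<otimes> v l, inv_letter l) = \<omega> (z, l)"
    and rel: "\<And>z w. z \<in> carrier G \<Longrightarrow> w \<in> R \<Longrightarrow> \<not> parity \<omega> (walk G v z w)"
    and w: "w \<in> lists letters" "ev w = \<one>" and x: "x \<in> carrier G"
  shows "\<not> parity \<omega> (walk G v x w)"
proof -
  let ?F = "free_group X"
  let ?par = "\<lambda>x w. parity \<omega> (walk G v x w)"
  interpret F: group ?F by (rule group_free_group)
  have push: "?par x (push_letter l w) = ?par x (l # w)"
    if "x \<in> carrier G" "l \<in> letters" "w \<in> lists letters" for x l w
  proof (cases "w \<noteq> [] \<and> hd w = inv_letter l")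
    case True
    then obtain w' where w': "w = inv_letter l # w'" by (cases w) auto
    have "x \<otimes> v l \<otimes> v (inv_letter l) = x"
      using that v_closed[OF that(2)] by (simp add: v_inv m_assoc)
    then show ?thesis using w' sym[OF that(1,2)] by (auto simp: cancels_iff)
  next
    case False
    then have "push_letter l w = l # w" by (cases w) (auto simp: cancels_iff)
    then show ?thesis by simp
  qed
  have fold: "?par x (foldr push_letter w c) = ?par x (w @ c)"
    if "x \<in> carrier G" "w \<in> lists letters" "c \<in> lists letters" for x w c
    using that
  proof (induction w arbitrary: x)
    case (Cons l w)
    then have "?par x (foldr push_letter (l # w) c) = ?par x (l # foldr push_letter w c)"
      using push[of x l "foldr push_letter w c"] foldr_push_mem[of w letters c] by simp
    also have "\<dots> = ?par x (l # w @ c)"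
      using Cons.IH[of "x \<otimes> v l"] Cons.prems v_closed by auto
    finally show ?case by simp
  qed simp
  have app: "?par x (w @ w') = (?par x w \<noteq> ?par (x \<otimes> ev w) w')"
    if "x \<in> carrier G" "w \<in> lists letters" for x w w'
    using walk_append[OF that] by (simp add: parity_append)
  have backwards: "?par (x \<otimes> ev w) (inv_word w) = ?par x w" if "x \<in> carrier G" "w \<in> lists letters" for x w
    using that
  proof (induction w arbitrary: x)
    case (Cons l w)
    have c: "v l \<in> carrier G" "ev w \<in> carrier G" "w \<in> lists letters" "x \<in> carrier G" "l \<in> letters"
      "inv_word w \<in> lists letters"
      using Cons v_closed inv_word_mem[of w X] by auto
    have "x \<otimes> (v l \<otimes> ev w) \<otimes> ev (inv_word w) = x \<otimes> v l"
      using c by (simp add: ev_inv_word m_assoc)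
    moreover have "inv_word (l # w) = inv_word w @ [inv_letter l]" by (simp add: inv_word_def)
    ultimately have "?par (x \<otimes> ev (l # w)) (inv_word (l # w))
      = (?par (x \<otimes> (v l \<otimes> ev w)) (inv_word w) \<noteq> \<omega> (x \<otimes> v l, inv_letter l))"
      using app[of "x \<otimes> (v l \<otimes> ev w)" "inv_word w" "[inv_letter l]"] c by simp
    also have "x \<otimes> (v l \<otimes> ev w) = x \<otimes> v l \<otimes> ev w" using c by (simp add: m_assoc)
    also have "?par (x \<otimes> v l \<otimes> ev w) (inv_word w) = ?par (x \<otimes> v l) w"
      using c by (intro Cons.IH) auto
    finally show ?case using sym[OF c(4,5)] by auto
  qed (simp add: inv_word_def)
  define N where "N = {w \<in> carrier ?F. ev w = \<one> \<and> (\<forall>x \<in> carrier G. \<not> ?par x w)}"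
  have words: "w \<in> lists letters" if "w \<in> carrier ?F" for w using that by simp
  have mult: "?par x (a \<otimes>\<^bsub>?F\<^esub> b) = (?par x a \<noteq> ?par (x \<otimes> ev a) b)" "ev (a \<otimes>\<^bsub>?F\<^esub> b) = ev a \<otimes> ev b"
    if "a \<in> carrier ?F" "b \<in> carrier ?F" "x \<in> carrier G" for a b x
    using fold app ev_foldr_push that by simp_all
  have invs: "?par x (inv\<^bsub>?F\<^esub> a) = ?par (x \<otimes> inv (ev a)) a" "ev (inv\<^bsub>?F\<^esub> a) = inv (ev a)"
    if "a \<in> carrier ?F" "x \<in> carrier G" for a x
  proof -
    have a: "a \<in> lists letters" "inv_word a \<in> lists letters" "ev a \<in> carrier G"
      using that inv_word_mem by auto
    have "?par x (inv\<^bsub>?F\<^esub> a) = ?par x (inv_word a)"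
      using inv_free_group[OF that(1)] fold[OF that(2) a(2), of "[]"] by simp
    also have "\<dots> = ?par (x \<otimes> inv (ev a) \<otimes> ev a) (inv_word a)"
      using a that by (simp add: m_assoc)
    also have "\<dots> = ?par (x \<otimes> inv (ev a)) a" using a that by (intro backwards) auto
    finally show "?par x (inv\<^bsub>?F\<^esub> a) = ?par (x \<otimes> inv (ev a)) a" .
    show "ev (inv\<^bsub>?F\<^esub> a) = inv (ev a)"
      using inv_free_group[OF that(1)] ev_foldr_push[OF a(2), of "[]"] ev_inv_word[OF a(1)] a by simp
  qed
  have evc: "ev a \<in> carrier G" if "a \<in> carrier ?F" for a using that by auto
  have "N \<lhd> ?F"
  proof (rule F.normal_inv_iff[THEN iffD2], intro conjI ballI)
    show "subgroup N ?F"
    proof (rule F.subgroupI)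
      have "[] \<in> N" unfolding N_def by simp
      then show "N \<noteq> {}" by blast
      show "inv\<^bsub>?F\<^esub> a \<in> N" if "a \<in> N" for a
        using that invs[of a] F.inv_closed[of a] unfolding N_def by auto
      show "a \<otimes>\<^bsub>?F\<^esub> b \<in> N" if "a \<in> N" "b \<in> N" for a b
        using that mult[of a b] F.m_closed[of a b] unfolding N_def
        by (auto simp del: free_group_simps)
    qed (auto simp: N_def)
    show "a \<otimes>\<^bsub>?F\<^esub> b \<otimes>\<^bsub>?F\<^esub> inv\<^bsub>?F\<^esub> a \<in> N" if a: "a \<in> carrier ?F" and b: "b \<in> N" for a b
    proof -
      have bc: "b \<in> carrier ?F" "ev b = \<one>" "\<And>x. x \<in> carrier G \<Longrightarrow> \<not> ?par x b"
        using b unfolding N_def by auto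
      note c = a bc(1) F.m_closed[OF a bc(1)] F.inv_closed[OF a] evc[OF a]
      have "ev (a \<otimes>\<^bsub>?F\<^esub> b \<otimes>\<^bsub>?F\<^esub> inv\<^bsub>?F\<^esub> a) = \<one>"
        using c mult(2)[OF c(3,4)] mult(2)[OF c(1,2)] invs(2)[OF a] bc(2) one_closed
        by (simp del: free_group_simps)
      moreover have "\<not> ?par x (a \<otimes>\<^bsub>?F\<^esub> b \<otimes>\<^bsub>?F\<^esub> inv\<^bsub>?F\<^esub> a)" if x: "x \<in> carrier G" for x
      proof -
        have "?par x (a \<otimes>\<^bsub>?F\<^esub> b \<otimes>\<^bsub>?F\<^esub> inv\<^bsub>?F\<^esub> a)
          = (?par x a \<noteq> ?par (x \<otimes> ev a \<otimes> inv (ev a)) a)"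
          using c mult[OF c(3,4) x] mult[OF c(1,2) x] invs(1)[OF a] bc x
          by (simp del: free_group_simps)
        then show ?thesis using c x by (simp add: m_assoc del: free_group_simps)
      qed
      ultimately show ?thesis
        unfolding N_def using F.m_closed[OF c(3,4)] by blast
    qed
  qed
  moreover have "R \<subseteq> N"
  proof
    fix r assume r: "r \<in> R"
    then show "r \<in> N" using R_words relators[OF r] rel[OF _ r] unfolding N_def by auto
  qed
  moreover have "ev (foldr push_letter w []) = \<one>" using w ev_foldr_push[OF w(1), of "[]"] by simp
  ultimately have "foldr push_letter w [] \<in> N"
    using kernel foldr_push_in_free_group[OF w(1)] by metis
  then have "\<not> ?par x (foldr push_letter w [])" unfolding N_def using x by auto
  then show ?thesis using fold[OF x w(1), of "[]"] by simp
qed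

end

section \<open>Boundaries in finitely presented groups\<close>

definition boundary :: "('a \<times> 'a) set \<Rightarrow> 'a set \<Rightarrow> 'a set \<Rightarrow> 'a set" where
  "boundary r E W = {u \<in> W. \<exists>e \<in> E. (u, e) \<in> r}"

definition coarsely_connected :: "('a \<times> 'a) set \<Rightarrow> nat \<Rightarrow> 'a set \<Rightarrow> bool" where
  "coarsely_connected r n B \<longleftrightarrow>
    (\<forall>u \<in> B. \<forall>v \<in> B. (u, v) \<in> {(x, y). x \<in> B \<and> y \<in> B \<and> (\<exists>k \<le> n. (x, y) \<in> r ^^ k)}\<^sup>*)"

text \<open>Coarse simple connectedness of a graph, in the form in which it serves to reroute paths
  around a connected set \<open>E\<close>.\<close>

definition coarsely_connected_boundaries :: "('a \<times> 'a) set \<Rightarrow> 'a set \<Rightarrow> nat \<Rightarrow> bool" where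
  "coarsely_connected_boundaries r X n \<longleftrightarrow>
    (\<forall>E x. E \<subseteq> X \<and> (\<forall>e \<in> E. \<forall>e' \<in> E. (e, e') \<in> linked r E) \<and> x \<in> X - E \<longrightarrow>
      coarsely_connected r n (boundary r E (linked r (X - E) `` {x})))"

context presentation
begin

abbreviation generators :: "'a set" where
  "generators \<equiv> v ` letters"

abbreviation edge :: "('a \<times> 'a) set" where
  "edge \<equiv> cayley_edges G generators"

lemma v_inv_cancel:
  "l \<in> letters \<Longrightarrow> z \<in> carrier G \<Longrightarrow> z \<otimes> v l \<otimes> v (inv_letter l) = z"
  using v_closed[of l] by (simp add: v_inv m_assoc del: mem_Sigma_iff)

lemma generators_inv: "generators \<union> m_inv G ` generators = generators"
proof -
  have "inv (v l) \<in> generators" if "l \<in> letters" for l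
    using that v_inv[OF that] inv_letter_mem[of l X] by (metis image_eqI)
  then show ?thesis by auto
qed

lemma edge_iff: "(x, y) \<in> edge \<longleftrightarrow> x \<in> carrier G \<and> (\<exists>l \<in> letters. y = x \<otimes> v l)"
  unfolding in_cayley_edges generators_inv by auto

lemma finite_generating_set_generators: "finite_generating_set G generators"
proof -
  have sub: "generators \<subseteq> carrier G" using v_closed by auto
  have "ev w \<in> generate G generators" if "w \<in> lists letters" for w
    using that
  proof (induction w)
    case (Cons l w)
    then have "v l \<in> generate G generators" "ev w \<in> generate G generators"
      by (auto intro: generate.incl)
    then show ?case by (simp add: generate.eng)
  qed (simp add: generate.one)
  then have "carrier G \<subseteq> generate G generators" using surjective by blast
  then show ?thesis
    unfolding finite_generating_set_def using sub finite_X generate_in_carrier[OF sub] by auto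
qed

lemma edge_power_word:
  "x \<in> carrier G \<Longrightarrow> w \<in> lists letters \<Longrightarrow> (x, x \<otimes> ev w) \<in> edge ^^ length w"
proof (induction w arbitrary: x)
  case (Cons l w)
  have c: "v l \<in> carrier G" "ev w \<in> carrier G" using Cons v_closed by auto
  have "(x, x \<otimes> v l) \<in> edge" unfolding edge_iff using Cons by auto
  moreover have "(x \<otimes> v l, x \<otimes> v l \<otimes> ev w) \<in> edge ^^ length w" using Cons c by auto
  ultimately show ?case using Cons c by (auto simp: m_assoc simp del: relpow.simps intro: relpow_Suc_I2)
qed simp

lemma sym_edge: "sym edge"
  using sym_cayley_edges v_closed by blast

lemma linked_word:
  assumes "(x, y) \<in> linked edge V" "x \<in> V" "x \<in> carrier G"
  shows "\<exists>w \<in> lists letters. y = x \<otimes> ev w \<and>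
    (\<forall>z l. (z, l) \<in> set (walk G v x w) \<longrightarrow> z \<in> V \<and> z \<otimes> v l \<in> V)"
  using assms(1)
proof (induction rule: linked_induct)
  case refl
  show ?case using assms by (intro bexI[of _ "[]"]) auto
next
  case (step y z)
  then obtain w where w: "w \<in> lists letters" "y = x \<otimes> ev w"
    "\<And>z l. (z, l) \<in> set (walk G v x w) \<Longrightarrow> z \<in> V \<and> z \<otimes> v l \<in> V" by auto
  obtain l where l: "l \<in> letters" "z = y \<otimes> v l" using step unfolding edge_iff by auto
  have c: "ev w \<in> carrier G" "v l \<in> carrier G" using w(1) l(1) v_closed by auto
  show ?case
  proof (intro bexI[of _ "w @ [l]"] conjI allI impI)
    show "w @ [l] \<in> lists letters" using w(1) l(1) by simp
    show "z = x \<otimes> ev (w @ [l])"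
      using w(1,2) l c ev_append[of w "[l]"] assms(3) by (simp add: m_assoc)
    fix a k assume "(a, k) \<in> set (walk G v x (w @ [l]))"
    then have "(a, k) \<in> set (walk G v x w) \<or> (a, k) = (y, l)"
      using walk_append[OF assms(3) w(1), of "[l]"] w(2) by auto
    then show "a \<in> V" "a \<otimes> v k \<in> V" using w(3)[of a k] step(2,3) l by auto
  qed
qed

text \<open>For two vertices of a relator loop, going back to the origin of the loop and out again bounds
  their distance by twice the length of the loop.\<close>

lemma walk_near:
  assumes "(z, l) \<in> set (walk G v x w)" "x \<in> carrier G" "w \<in> lists letters" "y \<in> {z, z \<otimes> v l}"
  shows "\<exists>k \<le> length w. (x, y) \<in> edge ^^ k"
proof -
  obtain w1 w2 where w: "w = w1 @ l # w2" "z = x \<otimes> ev w1" using walk_vertex[OF assms(1-3)] by auto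
  have w1: "w1 \<in> lists letters" "l \<in> letters" using w assms by auto
  have "y = x \<otimes> ev w1 \<or> y = x \<otimes> ev (w1 @ [l])"
    using assms(2,4) w w1 v_closed[OF w1(2)] ev_append[OF w1(1), of "[l]"] by (auto simp: m_assoc)
  then show ?thesis
  proof
    assume "y = x \<otimes> ev w1"
    then show ?thesis using edge_power_word[OF assms(2) w1(1)] w(1) by (intro exI[of _ "length w1"]) auto
  next
    assume "y = x \<otimes> ev (w1 @ [l])"
    then show ?thesis using edge_power_word[OF assms(2), of "w1 @ [l]"] w1 w(1)
      by (intro exI[of _ "length (w1 @ [l])"]) auto
  qed
qed

text \<open>Call two boundary points equivalent if they are joined by a chain of short jumps between boundary
  points.  Suppose that a class \<open>A\<close> of boundary points misses the boundary point \<open>z\<close>, and count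
  modulo 2 how often a walk crosses between \<open>A\<close> and \<open>E\<close>.  If a relator loop crosses there at all, then
  all boundary points on it lie in \<open>A\<close>, so that it crosses as often as it enters or leaves the
  component \<open>W\<close>, an even number of times.  Hence all loops cross an even number of times.  But the loop
  from \<open>E\<close> into \<open>A\<close>, then through \<open>W\<close> to \<open>z\<close>, back to \<open>E\<close> and through \<open>E\<close> to its origin crosses once.\<close>

theorem coarsely_connected_boundaries:
  assumes n: "\<And>w. w \<in> R \<Longrightarrow> 2 * length w \<le> n"
  shows "coarsely_connected_boundaries edge (carrier G) n"
  unfolding coarsely_connected_boundaries_def coarsely_connected_def
proof (intro allI impI ballI, elim conjE)
  fix E x a z
  assume E: "E \<subseteq> carrier G" and E_conn: "\<forall>e \<in> E. \<forall>e' \<in> E. (e, e') \<in> linked edge E"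
    and x: "x \<in> carrier G - E"
  define W where "W = linked edge (carrier G - E) `` {x}"
  assume a': "a \<in> boundary edge E (linked edge (carrier G - E) `` {x})"
    and z': "z \<in> boundary edge E (linked edge (carrier G - E) `` {x})"
  let ?B = "boundary edge E W"
  let ?near = "{(u, u'). u \<in> ?B \<and> u' \<in> ?B \<and> (\<exists>k \<le> n. (u, u') \<in> edge ^^ k)}"
  have a: "a \<in> ?B" and z: "z \<in> ?B" using a' z' unfolding W_def by auto
  have W: "W \<subseteq> carrier G - E" unfolding W_def using linked_mem[of x _ edge] x by auto
  have leave: "u' \<in> E" if "u \<in> W" "(u, u') \<in> edge" "u' \<in> carrier G - W" for u u'
  proof (rule ccontr)
    assume "u' \<notin> E"
    then have "(u, u') \<in> linked edge (carrier G - E)" using that W by (intro linked_step) auto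
    then show False using that linked_trans unfolding W_def by fastforce
  qed
  define A where "A = {u. (a, u) \<in> ?near\<^sup>*}"
  have AB: "A \<subseteq> ?B"
  proof
    fix u assume "u \<in> A"
    then have "(a, u) \<in> ?near\<^sup>*" by (simp add: A_def)
    then show "u \<in> ?B" by (induction rule: rtrancl_induct) (use a in auto)
  qed
  have A_near: "u' \<in> A" if "u \<in> A" "u' \<in> ?B" "k \<le> n" "(u, u') \<in> edge ^^ k" for u u' k
  proof -
    have "(u, u') \<in> ?near" using that AB by auto
    then show ?thesis using that(1) unfolding A_def by (auto intro: rtrancl_into_rtrancl)
  qed
  define \<omega> where "\<omega> = (\<lambda>(u, l). u \<in> A \<and> u \<otimes> v l \<in> E \<or> u \<in> E \<and> u \<otimes> v l \<in> A)"
  have AW: "A \<subseteq> W" using AB by (auto simp: boundary_def)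
  have sym: "\<omega> (u \<otimes> v l, inv_letter l) = \<omega> (u, l)" if "u \<in> carrier G" "l \<in> letters" for u l
    unfolding \<omega>_def using v_inv_cancel[OF that(2,1)] by auto
  have rel: "\<not> parity \<omega> (walk G v u w)" if u: "u \<in> carrier G" and w: "w \<in> R" for u w
  proof (cases "\<exists>(b, l) \<in> set (walk G v u w). \<omega> (b, l)")
    case False
    then show ?thesis using u w R_words by (intro parity_zero) auto
  next
    case True
    have wl: "w \<in> lists letters" using w R_words by auto
    obtain b l b' where b: "(b, l) \<in> set (walk G v u w)" "b' \<in> {b, b \<otimes> v l}" "b' \<in> A"
      using True unfolding \<omega>_def by auto
    have near: "c' \<in> A" if c': "(c, m) \<in> set (walk G v u w)" "c' \<in> {c, c \<otimes> v m}" "c' \<in> ?B" for c m c'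
    proof -
      obtain i j where ij: "i \<le> length w" "(u, b') \<in> edge ^^ i" "j \<le> length w" "(u, c') \<in> edge ^^ j"
        using walk_near[OF b(1) u wl b(2)] walk_near[OF c'(1) u wl c'(2)] by blast
      have "(b', c') \<in> edge ^^ (i + j)"
        unfolding relpow_add using ij(4) sym_relpow[OF sym_edge ij(2)] by auto
      moreover have "i + j \<le> n" using n[OF w] ij by simp
      ultimately show ?thesis using A_near b(3) c'(3) by blast
    qed
    have "parity \<omega> (walk G v u w) = ((u \<in> W) \<noteq> (u \<otimes> ev w \<in> W))"
    proof (rule parity_telescope[OF _ u wl])
      fix c m assume cm: "(c, m) \<in> set (walk G v u w)"
      obtain w1 w2 where w12: "w = w1 @ m # w2" "c = u \<otimes> ev w1" using walk_vertex[OF cm u wl] by auto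
      have c: "c \<in> carrier G" "m \<in> letters" "c \<otimes> v m \<in> carrier G"
        using w12 wl u v_closed[of m] ev_closed[of w1] by auto
      have e: "(c, c \<otimes> v m) \<in> edge" using c unfolding edge_iff by auto
      then have e': "(c \<otimes> v m, c) \<in> edge" using sym_edge by (auto dest: symD)
      have 1: "c \<in> A \<and> c \<otimes> v m \<in> E" if "c \<in> W" "c \<otimes> v m \<notin> W"
      proof -
        have "c \<otimes> v m \<in> E" using leave[OF that(1) e] c that by auto
        then show ?thesis using near[OF cm, of c] that e by (auto simp: boundary_def)
      qed
      have 2: "c \<in> E \<and> c \<otimes> v m \<in> A" if "c \<notin> W" "c \<otimes> v m \<in> W"
      proof -
        have "c \<in> E" using leave[OF that(2) e'] c that by auto
        then show ?thesis using near[OF cm, of "c \<otimes> v m"] that e' by (auto simp: boundary_def)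
      qed
      show "\<omega> (c, m) = ((c \<in> W) \<noteq> (c \<otimes> v m \<in> W))"
        unfolding \<omega>_def using 1 2 AW W by blast
    qed
    then show ?thesis using relators[OF w] u by simp
  qed
  show "(a, z) \<in> {(x', y). x' \<in> boundary edge E (linked edge (carrier G - E) `` {x}) \<and>
      y \<in> boundary edge E (linked edge (carrier G - E) `` {x}) \<and> (\<exists>k \<le> n. (x', y) \<in> edge ^^ k)}\<^sup>*"
    unfolding W_def[symmetric]
  proof (rule ccontr)
    assume "(a, z) \<notin> ?near\<^sup>*"
    then have zA: "z \<notin> A" by (simp add: A_def)
    have aA: "a \<in> A" by (simp add: A_def)
    have c: "a \<in> carrier G" "z \<in> carrier G" "a \<in> W" "z \<in> W" using a z W by (auto simp: boundary_def)
    obtain l where l: "l \<in> letters" "a \<otimes> v l \<in> E" using a unfolding boundary_def edge_iff by auto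
    obtain m where m: "m \<in> letters" "z \<otimes> v m \<in> E" using z unfolding boundary_def edge_iff by auto
    define e where "e = a \<otimes> v l"
    define e' where "e' = z \<otimes> v m"
    have ec: "e \<in> carrier G" "e' \<in> carrier G" "e \<in> E" "e' \<in> E"
      using E l m by (auto simp: e_def e'_def)
    have "(x, a) \<in> linked edge (carrier G - E)" "(x, z) \<in> linked edge (carrier G - E)"
      using c unfolding W_def by auto
    then have "(a, z) \<in> linked edge (carrier G - E)"
      by (rule linked_trans[OF linked_sym[OF sym_edge]])
    moreover have "linked edge (carrier G - E) `` {a} = W"
      using linked_component_eq[OF sym_edge, of x a] c unfolding W_def by simp
    ultimately have "(a, z) \<in> linked edge W" using linked_in_component by metis
    then obtain w where w: "w \<in> lists letters" "z = a \<otimes> ev w"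
      "\<And>u k. (u, k) \<in> set (walk G v a w) \<Longrightarrow> u \<in> W \<and> u \<otimes> v k \<in> W"
      using linked_word[of a z W] c by auto
    obtain w' where w': "w' \<in> lists letters" "e = e' \<otimes> ev w'"
      "\<And>u k. (u, k) \<in> set (walk G v e' w') \<Longrightarrow> u \<in> E \<and> u \<otimes> v k \<in> E"
      using linked_word[of e' e E] ec E_conn by auto
    have vl: "v l \<in> carrier G" "v m \<in> carrier G" "v (inv_letter l) \<in> carrier G"
      "ev w \<in> carrier G" "ev w' \<in> carrier G"
      using l m w(1) w'(1) v_closed[of l] v_closed[of m] v_closed[of "inv_letter l"] by auto
    have ea: "e \<otimes> v (inv_letter l) = a" unfolding e_def by (rule v_inv_cancel[OF l(1) c(1)])
    let ?loop = "inv_letter l # w @ m # w'"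
    have loop: "?loop \<in> lists letters"
      using l(1) m(1) w(1) w'(1) by simp
    have "e \<otimes> ev ?loop = e \<otimes> v (inv_letter l) \<otimes> ev w \<otimes> v m \<otimes> ev w'"
      using ec vl ev_append[OF w(1), of "m # w'"] m(1) w'(1) by (simp add: m_assoc)
    also have "\<dots> = e" unfolding ea using w(2) w'(2) e'_def by simp
    finally have "ev ?loop = \<one>" using ec(1) loop by (metis ev_closed l_cancel_one)
    then have "\<not> parity \<omega> (walk G v e ?loop)"
      by (intro parity_closed_walk[OF sym rel loop _ ec(1)])
    moreover have "walk G v e ?loop = (e, inv_letter l) # walk G v a w @ (z, m) # walk G v e' w'"
      using walk_append[OF c(1) w(1), of "m # w'"] w(2) by (simp add: ea e'_def)
    moreover have "\<not> parity \<omega> (walk G v a w)"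
      using w(3) W AW by (intro parity_zero[OF _ c(1) w(1)]) (auto simp: \<omega>_def)
    moreover have "\<not> parity \<omega> (walk G v e' w')"
      using w'(3) W AW by (intro parity_zero[OF _ ec(2) w'(1)]) (auto simp: \<omega>_def)
    moreover have "\<omega> (e, inv_letter l)" unfolding \<omega>_def using ea aA ec by simp
    moreover have "\<not> \<omega> (z, m)" unfolding \<omega>_def using zA c W by auto
    ultimately show False by (simp add: parity_append)
  qed
qed

end

theorem finitely_presented_coarsely_connected_boundaries:
  assumes "finitely_presented G" "group G"
  shows "\<exists>S n. finite_generating_set G S \<and>
    coarsely_connected_boundaries (cayley_edges G S) (carrier G) n"
proof -
  obtain X :: "nat set" and R v where "presentation G X R v"
    using finitely_presented_presentation[OF assms] by auto
  then interpret presentation G X R v .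
  have "length w \<le> Max (length ` R)" if "w \<in> R" for w using finite_R that by simp
  then have "coarsely_connected_boundaries edge (carrier G) (2 * Max (length ` R))"
    by (intro coarsely_connected_boundaries) simp
  then show ?thesis using finite_generating_set_generators by blast
qed

section \<open>One-ended finitely presented groups over another group\<close>

context group
begin

lemma relpow_left_mult:
  assumes "S \<subseteq> carrier G" "k \<in> carrier G" "(x, y) \<in> cayley_edges G S ^^ n"
  shows "(k \<otimes> x, k \<otimes> y) \<in> cayley_edges G S ^^ n"
  using assms(3)
proof (induction n arbitrary: y)
  case (Suc n)
  then show ?case using cayley_edges_left_mult[OF assms(1,2)] by auto
qed simp

end

text \<open>The set \<open>D\<close> is thought of as the region of \<open>H\<close> that a generator affects when it acts at the
  identity, and \<open>n\<close> bounds the jumps that are made when a path is led around a component.  The fibres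
  of \<open>\<pi>\<close> may be infinite; finiteness of the components replaces properness of \<open>\<pi>\<close>.\<close>

locale one_ended_over = group K + H: group H
  for K :: "('k, 'c) monoid_scheme" (structure) and H :: "('h, 'd) monoid_scheme" +
  fixes \<pi> :: "'k \<Rightarrow> 'h" and S :: "'k set" and n :: nat and D :: "'h set"
  assumes hom: "\<pi> \<in> hom K H"
    and one_ended: "one_ended K"
    and generating: "finite_generating_set K S"
    and boundaries: "coarsely_connected_boundaries (cayley_edges K S) (carrier K) n"
    and D: "finite D" "D \<subseteq> carrier H"
    and finite_components: "V \<subseteq> carrier K \<Longrightarrow> finite (\<pi> ` V) \<Longrightarrow> x \<in> carrier K \<Longrightarrow>
      finite (linked (cayley_edges K S) V `` {x})"
begin

abbreviation edge :: "('k \<times> 'k) set" where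
  "edge \<equiv> cayley_edges K S"

definition touch :: "'h set \<Rightarrow> 'k set" where
  "touch Q = {z \<in> carrier K. \<exists>d \<in> D. \<pi> z \<otimes>\<^bsub>H\<^esub> d \<in> Q}"

definition thick :: "'h set \<Rightarrow> 'k set" where
  "thick Q = {x \<in> carrier K. \<exists>z \<in> touch Q. \<exists>i \<le> n. (x, z) \<in> edge ^^ i}"

abbreviation comp :: "'h set \<Rightarrow> 'k \<Rightarrow> 'k set" where
  "comp Q e \<equiv> linked edge (thick Q) `` {e}"

text \<open>The points on the infinite side of every component of the thickened preimage of \<open>Q\<close>.  Removing
  \<open>thick Q\<close> itself would not do, since it may be infinite and may cut the graph into many pieces.\<close>

definition outside :: "'h set \<Rightarrow> 'k set" where
  "outside Q = {x \<in> carrier K. \<forall>e \<in> thick Q. x \<notin> filling edge (carrier K) (comp Q e)}"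

sublocale connected_graph "carrier K" edge
  by (rule connected_graph_cayley[OF generating])

sublocale \<pi>: group_hom K H \<pi>
  using hom by unfold_locales

lemma S: "S \<subseteq> carrier K"
  using generating unfolding finite_generating_set_def by auto

lemma touch_subset_thick: "touch Q \<subseteq> thick Q"
proof
  fix x assume "x \<in> touch Q"
  then show "x \<in> thick Q"
    unfolding thick_def touch_def by (auto intro!: exI[of _ "0 :: nat"])
qed

lemma thick_mono: "Q \<subseteq> Q' \<Longrightarrow> thick Q \<subseteq> thick Q'"
  unfolding thick_def touch_def by blast

lemma comp_mem: "e \<in> thick Q \<Longrightarrow> comp Q e \<subseteq> thick Q" "e \<in> thick Q \<Longrightarrow> e \<in> comp Q e"
  using linked_mem[of e _ edge "thick Q"] by auto

lemma thick_carrier: "thick Q \<subseteq> carrier K"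
  unfolding thick_def by auto

lemma finite_image_thick:
  assumes "finite Q" "Q \<subseteq> carrier H" shows "finite (\<pi> ` thick Q)"
proof (rule finite_subset)
  define B where "B = (\<Union>i \<le> n. (edge ^^ i) `` {\<one>})"
  let ?f = "\<lambda>(q, d, w). q \<otimes>\<^bsub>H\<^esub> inv\<^bsub>H\<^esub> d \<otimes>\<^bsub>H\<^esub> \<pi> w"
  show "finite (?f ` (Q \<times> D \<times> B))" unfolding B_def using assms D finite_relpow by auto
  show "\<pi> ` thick Q \<subseteq> ?f ` (Q \<times> D \<times> B)"
  proof
    fix h assume "h \<in> \<pi> ` thick Q"
    then obtain x z d i where x: "x \<in> carrier K" "h = \<pi> x" "z \<in> carrier K" "d \<in> D" "\<pi> z \<otimes>\<^bsub>H\<^esub> d \<in> Q"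
      "i \<le> n" "(x, z) \<in> edge ^^ i"
      unfolding thick_def touch_def by auto
    have "(inv z \<otimes> z, inv z \<otimes> x) \<in> edge ^^ i"
      using relpow_left_mult[OF S inv_closed[OF x(3)] sym_relpow[OF sym_edges x(7)]] .
    then have "(\<one>, inv z \<otimes> x) \<in> edge ^^ i" using x(3) by simp
    then have "inv z \<otimes> x \<in> B" unfolding B_def using x(6) by blast
    moreover have "h = \<pi> z \<otimes>\<^bsub>H\<^esub> d \<otimes>\<^bsub>H\<^esub> inv\<^bsub>H\<^esub> d \<otimes>\<^bsub>H\<^esub> \<pi> (inv z \<otimes> x)"
      using x D(2) by (simp add: H.m_assoc subset_iff H.r_inv_ex) (simp add: H.m_assoc[symmetric])
    ultimately show "h \<in> ?f ` (Q \<times> D \<times> B)" using x by force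
  qed
qed

lemma finite_comp:
  assumes "finite Q" "Q \<subseteq> carrier H" "e \<in> thick Q"
  shows "finite (comp Q e)" "finite (filling edge (carrier K) (comp Q e))"
proof -
  show fin: "finite (comp Q e)"
    using assms finite_components[OF thick_carrier finite_image_thick] thick_carrier by blast
  show "finite (filling edge (carrier K) (comp Q e))"
    using fin comp_mem[OF assms(3)] thick_carrier by (intro finite_filling) blast+
qed

lemma outside_mono:
  assumes "Q \<subseteq> Q'" shows "outside Q' \<subseteq> outside Q"
proof
  fix x assume x: "x \<in> outside Q'"
  have "x \<notin> filling edge (carrier K) (comp Q e)" if e: "e \<in> thick Q" for e
  proof -
    have "comp Q e \<subseteq> comp Q' e" using linked_mono[OF thick_mono[OF assms]] by auto
    then have "filling edge (carrier K) (comp Q e) \<subseteq> filling edge (carrier K) (comp Q' e)"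
      by (rule filling_mono)
    then show ?thesis using x e thick_mono[OF assms] unfolding outside_def by auto
  qed
  then show "x \<in> outside Q" using x unfolding outside_def by auto
qed

text \<open>A path between two outside points that meets a component is led around it: since one
  end of the path can be joined to the other off the component, both the first entrance and the
  last exit lie on the boundary of one and the same complementary component, and that boundary is
  coarsely connected.  The jumps are too short to reach the unthickened preimage.\<close>

lemma outside_linked:
  assumes Q: "finite Q" "Q \<subseteq> carrier H" and x: "x \<in> outside Q" and y: "y \<in> outside Q"
  shows "(x, y) \<in> linked edge (carrier K - touch Q)"
proof -
  let ?V = "carrier K - touch Q"
  have "(x, y) \<in> linked edge ?V" if "path edge (carrier K) xs" "hd xs = x" "last xs = y" for xs
    using that
  proof (induction "length (filter (\<lambda>a. a \<in> touch Q) xs)" arbitrary: xs rule: less_induct)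
    case less
    show ?case
    proof (cases "set xs \<inter> touch Q = {}")
      case True
      then have "path edge ?V xs" using less.prems by (auto simp: path_def)
      then show ?thesis using path_linked less.prems by metis
    next
      case False
      then obtain b where b: "b \<in> set xs" "b \<in> touch Q" by auto
      define E where "E = comp Q b"
      have bt: "b \<in> thick Q" using b touch_subset_thick by auto
      have bE: "b \<in> E" "E \<subseteq> thick Q" using comp_mem[OF bt] unfolding E_def by auto
      have E: "finite E" "E \<subseteq> carrier K"
        using finite_comp[OF Q bt] bE thick_carrier unfolding E_def by auto
      have fill: "x \<in> carrier K - filling edge (carrier K) E" "y \<in> carrier K - filling edge (carrier K) E"
        using x y bt unfolding outside_def E_def by auto
      then have xyE: "x \<in> carrier K - E" "y \<in> carrier K - E" using subset_filling[OF E(2), of edge] by auto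
      define W where "W = linked edge (carrier K - E) `` {x}"
      have yW: "(x, y) \<in> linked edge (carrier K - E)"
        by (rule one_ended_linked[OF one_ended generating E fill])
      have E_conn: "(e, e') \<in> linked edge E" if "e \<in> E" "e' \<in> E" for e e'
      proof -
        have "comp Q e = E"
          using that linked_component_eq[OF sym_edges, of b e] unfolding E_def by auto
        then show ?thesis using linked_in_component[of e e' edge "thick Q"] that by auto
      qed
      let ?B = "boundary edge E W"
      have chain: "(u, v) \<in> {(u, v). u \<in> ?B \<and> v \<in> ?B \<and> (\<exists>k \<le> n. (u, v) \<in> edge ^^ k)}\<^sup>*"
        if "u \<in> ?B" "v \<in> ?B" for u v
        using boundaries[unfolded coarsely_connected_boundaries_def, rule_format, of E x]
          E(2) E_conn xyE(1) that unfolding W_def coarsely_connected_def by blast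
      have near: "u \<in> carrier K - thick Q" if u: "u \<in> ?B" for u
      proof -
        obtain e where e: "e \<in> E" "(u, e) \<in> edge" using u unfolding boundary_def by auto
        have uE: "u \<in> carrier K - E"
          using u linked_mem[of x u edge "carrier K - E"] xyE unfolding boundary_def W_def by auto
        have "u \<notin> thick Q"
        proof
          assume "u \<in> thick Q"
          then have "(e, u) \<in> linked edge (thick Q)"
            using e bE sym_edges by (intro linked_step) (auto dest: symD)
          then have "u \<in> E" using e(1) linked_trans unfolding E_def by fastforce
          then show False using uE by simp
        qed
        then show ?thesis using uE by simp
      qed
      have jump: "(u, v) \<in> linked edge ?V" if uv: "u \<in> ?B" "k \<le> n" "(u, v) \<in> edge ^^ k" for u v k
      proof (rule linked_if_relpow[OF uv(3)])
        fix z i assume i: "i \<le> k" "(u, z) \<in> edge ^^ i"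
        have u: "u \<in> carrier K - thick Q" by (rule near[OF uv(1)])
        have "u \<in> thick Q" if "z \<in> touch Q"
          unfolding thick_def using that u i order_trans[OF i(1) uv(2)] by blast
        then have "z \<notin> touch Q" using u by blast
        moreover have "z \<in> carrier K"
          using i(2) u edges by (cases i) auto
        ultimately show "z \<in> ?V" by simp
      qed
      obtain ys e zs where vs: "xs = ys @ e # zs" "e \<in> E" "\<forall>a \<in> set ys. a \<notin> E"
        using split_list_first_prop[of xs "\<lambda>a. a \<in> E"] b bE by blast
      obtain ys' e' zs' where vs': "e # zs = ys' @ e' # zs'" "e' \<in> E" "\<forall>a \<in> set zs'. a \<notin> E"
        using split_list_last_prop[of "e # zs" "\<lambda>a. a \<in> E"] vs(2) by auto
      have xs: "xs = ys @ (ys' @ [e']) @ zs'" using vs vs' by simp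
      have "ys \<noteq> []" using less.prems(2) vs(1,2) xyE(1) by auto
      moreover have "zs' \<noteq> []" using less.prems(3) xs vs'(2) xyE(2) by auto
      ultimately have ne: "ys \<noteq> []" "zs' \<noteq> []" .
      define u where "u = last ys"
      define v where "v = hd zs'"
      have "path edge (carrier K) ys" "(u, e) \<in> edge\<^sup>="
        using path_appendD[of edge "carrier K" ys "e # zs"] less.prems(1) vs ne unfolding u_def by auto
      moreover have "u \<notin> E" using vs ne u_def by auto
      moreover have "hd ys = x" using less.prems(2) ne xs by auto
      ultimately have u: "(u, e) \<in> edge" "path edge (carrier K) ys" "(x, u) \<in> linked edge (carrier K - E)"
        using vs(2,3) path_linked[of edge "carrier K - E" ys] unfolding u_def by (auto simp: path_def)
      have "path edge (carrier K) zs'" "(e', v) \<in> edge\<^sup>="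
        using path_appendD[of edge "carrier K" "ys @ ys' @ [e']" zs'] less.prems(1) xs ne
        unfolding v_def by auto
      moreover have "v \<notin> E" using vs' ne v_def by auto
      moreover have "last zs' = y" using less.prems(3) ne xs by auto
      ultimately have v: "(e', v) \<in> edge" "path edge (carrier K) zs'" "(v, y) \<in> linked edge (carrier K - E)"
        using vs'(2,3) path_linked[of edge "carrier K - E" zs'] unfolding v_def by (auto simp: path_def)
      have "(x, v) \<in> linked edge (carrier K - E)"
        using linked_trans[OF yW linked_sym[OF sym_edges v(3)]] .
      then have B: "u \<in> ?B" "v \<in> ?B"
        using u v vs(2) vs'(2) sym_edges unfolding boundary_def W_def by (auto dest: symD)
      have "(u, v) \<in> linked edge ?V"
        using chain[OF B]
      proof (induction rule: rtrancl_induct)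
        case (step v' v'')
        then obtain k where "v' \<in> ?B" "k \<le> n" "(v', v'') \<in> edge ^^ k" by auto
        then show ?case using jump step.IH linked_trans by metis
      qed simp
      moreover have "u \<in> ?V" using near[OF B(1)] touch_subset_thick by auto
      ultimately obtain ms where ms: "path edge ?V ms" "hd ms = u" "last ms = v"
        using linked_path by metis
      \<comment> \<open>All of the piece that was cut out, which contains \<open>b\<close>, is replaced by points of \<open>?V\<close>.\<close>
      let ?xs = "ys @ ms @ zs'"
      have "path edge (carrier K) ms" using ms(1) by (auto simp: path_def)
      then have new: "path edge (carrier K) ?xs"
        using u(2) v(2) ms ne by (intro path_append) (auto simp: u_def v_def path_def)
      have ends: "hd ?xs = x" "last ?xs = y" using ne less.prems xs by auto
      have ms0: "filter (\<lambda>a. a \<in> touch Q) ms = []"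
        using ms(1) by (auto simp: path_def filter_empty_conv)
      have "b \<in> set (ys' @ [e'])"
        using b(1) bE(1) vs(3) vs'(3) xs by auto
      then have "filter (\<lambda>a. a \<in> touch Q) (ys' @ [e']) \<noteq> []"
        using b(2) unfolding filter_empty_conv by blast
      then have "0 < length (filter (\<lambda>a. a \<in> touch Q) (ys' @ [e']))" by blast
      then have "length (filter (\<lambda>a. a \<in> touch Q) ?xs) < length (filter (\<lambda>a. a \<in> touch Q) xs)"
        unfolding xs filter_append length_append ms0 by simp
      then show ?thesis using new ends by (rule less.hyps)
    qed
  qed
  moreover have "x \<in> carrier K" "y \<in> carrier K" using x y by (auto simp: outside_def)
  ultimately show ?thesis using linked_path[OF connected] by metis
qed

lemma thick_left_mult:
  assumes k: "k \<in> carrier K" and Q: "Q \<subseteq> carrier H"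
  shows "thick (\<pi> k <#\<^bsub>H\<^esub> Q) = (\<otimes>) k ` thick Q"
proof
  have sub: "(\<otimes>) k ` thick Q \<subseteq> thick (\<pi> k <#\<^bsub>H\<^esub> Q)" if k: "k \<in> carrier K" for k Q
  proof
    fix y assume "y \<in> (\<otimes>) k ` thick Q"
    then obtain x z i d where x: "y = k \<otimes> x" "x \<in> carrier K" "z \<in> carrier K" "d \<in> D" "\<pi> z \<otimes>\<^bsub>H\<^esub> d \<in> Q"
      "i \<le> n" "(x, z) \<in> edge ^^ i"
      unfolding thick_def touch_def by auto
    have "\<pi> (k \<otimes> z) \<otimes>\<^bsub>H\<^esub> d = \<pi> k \<otimes>\<^bsub>H\<^esub> (\<pi> z \<otimes>\<^bsub>H\<^esub> d)"
      using x(3,4) k D(2) by (simp add: H.m_assoc subset_iff)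
    then have "k \<otimes> z \<in> touch (\<pi> k <#\<^bsub>H\<^esub> Q)"
      unfolding touch_def l_coset_def using x k by auto
    then show "y \<in> thick (\<pi> k <#\<^bsub>H\<^esub> Q)"
      unfolding thick_def using x k relpow_left_mult[OF S k x(7)] by auto
  qed
  show "(\<otimes>) k ` thick Q \<subseteq> thick (\<pi> k <#\<^bsub>H\<^esub> Q)" by (rule sub[OF k])
  have "\<pi> (inv k) <#\<^bsub>H\<^esub> (\<pi> k <#\<^bsub>H\<^esub> Q) = Q"
    using k Q by (simp add: H.lcos_m_assoc H.lcos_mult_one)
  then have "(\<otimes>) (inv k) ` thick (\<pi> k <#\<^bsub>H\<^esub> Q) \<subseteq> thick Q"
    using sub[of "inv k" "\<pi> k <#\<^bsub>H\<^esub> Q"] k by simp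
  then have "(\<otimes>) (inv (inv k)) ` (\<otimes>) (inv k) ` thick (\<pi> k <#\<^bsub>H\<^esub> Q) \<subseteq> (\<otimes>) k ` thick Q"
    using k by auto
  then show "thick (\<pi> k <#\<^bsub>H\<^esub> Q) \<subseteq> (\<otimes>) k ` thick Q"
    using left_mult_image_inv[OF inv_closed[OF k] thick_carrier] by simp
qed

lemma comp_left_mult:
  assumes "k \<in> carrier K" "Q \<subseteq> carrier H" "e \<in> carrier K"
  shows "comp (\<pi> k <#\<^bsub>H\<^esub> Q) (k \<otimes> e) = (\<otimes>) k ` comp Q e"
  unfolding thick_left_mult[OF assms(1,2)]
  by (rule component_left_mult[OF S assms(1) thick_carrier assms(3)])

lemma filling_comp_left_mult:
  assumes "k \<in> carrier K" "Q \<subseteq> carrier H" "e \<in> thick Q" "x \<in> carrier K"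
  shows "k \<otimes> x \<in> filling edge (carrier K) (comp (\<pi> k <#\<^bsub>H\<^esub> Q) (k \<otimes> e))
    \<longleftrightarrow> x \<in> filling edge (carrier K) (comp Q e)"
proof -
  have e: "e \<in> carrier K" and c: "comp Q e \<subseteq> carrier K"
    using assms(3) comp_mem[OF assms(3)] thick_carrier by blast+
  show ?thesis
    unfolding comp_left_mult[OF assms(1,2) e] by (rule filling_left_mult[OF S assms(1) c assms(4)])
qed

lemma outside_left_mult:
  assumes k: "k \<in> carrier K" and Q: "Q \<subseteq> carrier H" and x: "x \<in> outside Q"
  shows "k \<otimes> x \<in> outside (\<pi> k <#\<^bsub>H\<^esub> Q)"
proof -
  have "x \<in> carrier K" using x by (simp add: outside_def)
  moreover have "k \<otimes> x \<notin> filling edge (carrier K) (comp (\<pi> k <#\<^bsub>H\<^esub> Q) e')"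
    if "e' \<in> thick (\<pi> k <#\<^bsub>H\<^esub> Q)" for e'
  proof -
    obtain e where "e \<in> thick Q" "e' = k \<otimes> e" using \<open>e' \<in> _\<close> unfolding thick_left_mult[OF k Q] by auto
    then show ?thesis using filling_comp_left_mult[OF k Q] x by (auto simp: outside_def)
  qed
  ultimately show ?thesis using k unfolding outside_def by auto
qed

text \<open>Up to translation there are only finitely many pairs consisting of a translate of \<open>Q\<close> and a
  component of its thickened preimage, and each component has a finite filling.\<close>

lemma finite_not_outside:
  assumes Q: "finite Q" "Q \<subseteq> carrier H"
  shows "finite {p \<in> carrier H. \<one> \<notin> outside (p <#\<^bsub>H\<^esub> Q)}"
proof -
  define B where "B = (\<Union>i \<le> n. (edge ^^ i) `` {\<one>})"
  define Z where "Z = {q \<in> carrier H. \<one> \<in> thick (q <#\<^bsub>H\<^esub> Q)}"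
  let ?f = "\<lambda>(z, d, s). \<pi> z \<otimes>\<^bsub>H\<^esub> d \<otimes>\<^bsub>H\<^esub> inv\<^bsub>H\<^esub> s"
  have lQ: "finite (q <#\<^bsub>H\<^esub> Q)" "q <#\<^bsub>H\<^esub> Q \<subseteq> carrier H" if "q \<in> carrier H" for q
    using Q that by (auto simp: l_coset_def)
  have "Z \<subseteq> ?f ` (B \<times> D \<times> Q)"
  proof
    fix q assume "q \<in> Z"
    then obtain z i d s where q: "q \<in> carrier H" "z \<in> carrier K" "i \<le> n" "(\<one>, z) \<in> edge ^^ i" "d \<in> D"
      "s \<in> Q" "\<pi> z \<otimes>\<^bsub>H\<^esub> d = q \<otimes>\<^bsub>H\<^esub> s"
      unfolding Z_def thick_def touch_def l_coset_def by auto
    then have "q = \<pi> z \<otimes>\<^bsub>H\<^esub> d \<otimes>\<^bsub>H\<^esub> inv\<^bsub>H\<^esub> s" using Q by (simp add: H.m_assoc subset_iff)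
    moreover have "z \<in> B" unfolding B_def using q by auto
    ultimately show "q \<in> ?f ` (B \<times> D \<times> Q)" using q by force
  qed
  moreover have "finite (?f ` (B \<times> D \<times> Q))" unfolding B_def using Q D finite_relpow by auto
  ultimately have Z: "finite Z" by (rule finite_subset)
  define Y where "Y = (\<Union>q \<in> Z. filling edge (carrier K) (comp (q <#\<^bsub>H\<^esub> Q) \<one>))"
  have Y: "finite Y" unfolding Y_def using Z finite_comp lQ unfolding Z_def by auto
  have "{p \<in> carrier H. \<one> \<notin> outside (p <#\<^bsub>H\<^esub> Q)} \<subseteq> (\<lambda>(y, q). inv\<^bsub>H\<^esub> (\<pi> y) \<otimes>\<^bsub>H\<^esub> q) ` (Y \<times> Z)"
  proof
    fix p assume "p \<in> {p \<in> carrier H. \<one> \<notin> outside (p <#\<^bsub>H\<^esub> Q)}"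
    then obtain e where p: "p \<in> carrier H" and e: "e \<in> thick (p <#\<^bsub>H\<^esub> Q)" "\<one> \<in> filling edge (carrier K) (comp (p <#\<^bsub>H\<^esub> Q) e)"
      by (auto simp: outside_def)
    have ec: "e \<in> carrier K" using e(1) thick_carrier by auto
    define k where "k = inv e"
    define q where "q = \<pi> k \<otimes>\<^bsub>H\<^esub> p"
    have k: "k \<in> carrier K" "k \<otimes> e = \<one>" "q \<in> carrier H" using ec p by (auto simp: k_def q_def)
    have qQ: "q <#\<^bsub>H\<^esub> Q = \<pi> k <#\<^bsub>H\<^esub> (p <#\<^bsub>H\<^esub> Q)" unfolding q_def using k p Q by (simp add: H.lcos_m_assoc)
    have "\<one> \<in> thick (q <#\<^bsub>H\<^esub> Q)"
      unfolding qQ thick_left_mult[OF k(1) lQ(2)[OF p]] k(2)[symmetric] using e(1) by simp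
    then have qZ: "q \<in> Z" using k by (simp add: Z_def)
    have "k \<otimes> \<one> \<in> filling edge (carrier K) (comp (\<pi> k <#\<^bsub>H\<^esub> (p <#\<^bsub>H\<^esub> Q)) (k \<otimes> e))"
      using filling_comp_left_mult[OF k(1) lQ(2)[OF p] e(1), of \<one>] e(2) by simp
    then have "k \<in> Y" using qZ k unfolding Y_def qQ[symmetric] k(2) by auto
    moreover have "p = inv\<^bsub>H\<^esub> (\<pi> k) \<otimes>\<^bsub>H\<^esub> q" unfolding q_def using k p by (simp add: H.m_assoc[symmetric])
    ultimately show "p \<in> (\<lambda>(y, q). inv\<^bsub>H\<^esub> (\<pi> y) \<otimes>\<^bsub>H\<^esub> q) ` (Y \<times> Z)" using qZ by auto
  qed
  then show ?thesis by (rule finite_subset) (use Y Z in simp)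
qed

text \<open>The image of \<open>K\<close> in \<open>H\<close> is infinite, as otherwise \<open>K\<close> would be a finite component of the preimage
  of its image.  Hence some translate of \<open>Q\<close> under \<open>K\<close> has the identity outside of it.\<close>

lemma outside_nonempty:
  assumes Q: "finite Q" "Q \<subseteq> carrier H"
  shows "outside Q \<noteq> {}"
proof -
  have "infinite (\<pi> ` carrier K)"
  proof
    assume "finite (\<pi> ` carrier K)"
    then have "finite (linked edge (carrier K) `` {\<one>})" by (intro finite_components) auto
    moreover have "carrier K \<subseteq> linked edge (carrier K) `` {\<one>}" using connected by auto
    ultimately show False using one_ended_infinite[OF one_ended] finite_subset by blast
  qed
  then have "\<not> \<pi> ` carrier K \<subseteq> {p \<in> carrier H. \<one> \<notin> outside (p <#\<^bsub>H\<^esub> Q)}"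
    using finite_not_outside[OF Q] finite_subset by blast
  then obtain k where k: "k \<in> carrier K" "\<one> \<in> outside (\<pi> k <#\<^bsub>H\<^esub> Q)" by auto
  have "inv k \<otimes> \<one> \<in> outside (\<pi> (inv k) <#\<^bsub>H\<^esub> (\<pi> k <#\<^bsub>H\<^esub> Q))"
    using k Q by (intro outside_left_mult) (auto simp: l_coset_def)
  moreover have "\<pi> (inv k) <#\<^bsub>H\<^esub> (\<pi> k <#\<^bsub>H\<^esub> Q) = Q"
    using k Q by (simp add: H.lcos_m_assoc H.lcos_mult_one)
  ultimately show ?thesis by auto
qed

end

section \<open>Word metrics\<close>

definition neighbourhood :: "('a, 'b) monoid_scheme \<Rightarrow> 'a set \<Rightarrow> real \<Rightarrow> 'a set \<Rightarrow> 'a set" where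
  "neighbourhood G A \<kappa> R = {h \<in> carrier G. \<exists>r \<in> R. word_dist G A r h < \<kappa>}"

lemma set_dist_outside_neighbourhood:
  assumes "Y \<subseteq> carrier G - neighbourhood G A \<kappa> R"
  shows "set_dist (word_dist G A) R Y \<ge> ereal \<kappa>"
proof -
  have "\<kappa> \<le> word_dist G A r y" if "r \<in> R" "y \<in> Y" for r y
    using that assms unfolding neighbourhood_def by force
  then show ?thesis unfolding set_dist_def by (auto simp: le_INF_iff)
qed

context group
begin

lemma word_product_closed:
  "set w \<subseteq> carrier G \<Longrightarrow> foldr (\<otimes>) w \<one> \<in> carrier G"
  by (induction w) auto

lemma word_product_append:
  "set w \<subseteq> carrier G \<Longrightarrow> set w' \<subseteq> carrier G \<Longrightarrow>
    foldr (\<otimes>) (w @ w') \<one> = foldr (\<otimes>) w \<one> \<otimes> foldr (\<otimes>) w' \<one>"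
  by (induction w) (auto simp: word_product_closed m_assoc)

lemma generate_word:
  assumes "A \<subseteq> carrier G" "g \<in> generate G A"
  shows "\<exists>w. set w \<subseteq> A \<union> m_inv G ` A \<and> foldr (\<otimes>) w \<one> = g"
  using assms(2)
proof (induction rule: generate.induct)
  case one
  show ?case by (intro exI[of _ "[]"]) simp
next
  case (incl h)
  then show ?case using assms(1) by (intro exI[of _ "[h]"]) auto
next
  case (inv h)
  then show ?case using assms(1) by (intro exI[of _ "[inv h]"]) auto
next
  case (eng h1 h2)
  then obtain w1 w2 where w: "set w1 \<subseteq> A \<union> m_inv G ` A" "foldr (\<otimes>) w1 \<one> = h1"
    "set w2 \<subseteq> A \<union> m_inv G ` A" "foldr (\<otimes>) w2 \<one> = h2" by auto
  have "A \<union> m_inv G ` A \<subseteq> carrier G" using assms(1) by auto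
  then have "set w1 \<subseteq> carrier G" "set w2 \<subseteq> carrier G" using w by blast+
  then show ?case using w word_product_append by (intro exI[of _ "w1 @ w2"]) auto
qed

lemma finite_neighbourhood:
  assumes A: "finite_generating_set G A" and R: "finite R" "R \<subseteq> carrier G"
  shows "finite (neighbourhood G A \<kappa> R)"
proof (rule finite_subset)
  let ?A = "A \<union> m_inv G ` A"
  let ?W = "{w. set w \<subseteq> ?A \<and> length w \<le> nat \<lceil>\<kappa>\<rceil>}"
  let ?f = "\<lambda>(r, w). r \<otimes> foldr (\<otimes>) w \<one>"
  have Ac: "finite A" "A \<subseteq> carrier G" "generate G A = carrier G"
    using A unfolding finite_generating_set_def by auto
  show "finite (?f ` (R \<times> ?W))"
    using R Ac by (intro finite_imageI finite_cartesian_product finite_lists_length_le) auto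
  show "neighbourhood G A \<kappa> R \<subseteq> ?f ` (R \<times> ?W)"
  proof
    fix h assume "h \<in> neighbourhood G A \<kappa> R"
    then obtain r where r: "h \<in> carrier G" "r \<in> R" "word_length G A (inv r \<otimes> h) < \<kappa>"
      unfolding neighbourhood_def word_dist_def by auto
    have rc: "r \<in> carrier G" using r R by auto
    have "\<exists>n w. length w = n \<and> set w \<subseteq> ?A \<and> foldr (\<otimes>) w \<one> = inv r \<otimes> h"
      using generate_word[OF Ac(2), of "inv r \<otimes> h"] Ac(3) r rc by auto
    then have "\<exists>w. length w = word_length G A (inv r \<otimes> h) \<and> set w \<subseteq> ?A \<and> foldr (\<otimes>) w \<one> = inv r \<otimes> h"
      unfolding word_length_def by (rule LeastI_ex)
    then obtain w where w: "length w = word_length G A (inv r \<otimes> h)" "set w \<subseteq> ?A"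
      "foldr (\<otimes>) w \<one> = inv r \<otimes> h" by auto
    have "w \<in> ?W" using w(1,2) r(3) by (simp add: le_nat_iff) linarith
    moreover have "h = r \<otimes> foldr (\<otimes>) w \<one>" unfolding w(3) using r rc by (simp add: m_assoc[symmetric])
    ultimately show "h \<in> ?f ` (R \<times> ?W)" using r(2) by auto
  qed
qed

end

section \<open>Halo products\<close>

lemma semidirect_product_simps [simp]:
  "carrier (semidirect_product G H \<alpha>) = carrier G \<times> carrier H"
  "x \<otimes>\<^bsub>semidirect_product G H \<alpha>\<^esub> y = (fst x \<otimes>\<^bsub>G\<^esub> \<alpha> (snd x) (fst y), snd x \<otimes>\<^bsub>H\<^esub> snd y)"
  "\<one>\<^bsub>semidirect_product G H \<alpha>\<^esub> = (\<one>\<^bsub>G\<^esub>, \<one>\<^bsub>H\<^esub>)"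
  by (auto simp: semidirect_product_def split: prod.splits)

context halo_product_data
begin

abbreviation LH :: "('g \<times> 'h) monoid" where
  "LH \<equiv> semidirect_product G H \<alpha>"

lemma action_closed [simp]: "h \<in> carrier H \<Longrightarrow> a \<in> carrier G \<Longrightarrow> \<alpha> h a \<in> carrier G"
  and action_mult: "h \<in> carrier H \<Longrightarrow> a \<in> carrier G \<Longrightarrow> b \<in> carrier G \<Longrightarrow>
    \<alpha> h (a \<otimes>\<^bsub>G\<^esub> b) = \<alpha> h a \<otimes>\<^bsub>G\<^esub> \<alpha> h b"
  using hom_in_carrier[OF action_hom, of h]
  by (auto simp: AutoGroup_def auto_def hom_def BijGroup_def)

lemma action_comp:
  assumes "h \<in> carrier H" "k \<in> carrier H" "a \<in> carrier G"
  shows "\<alpha> (h \<otimes>\<^bsub>H\<^esub> k) a = \<alpha> h (\<alpha> k a)"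
proof -
  have "\<alpha> h \<in> Bij (carrier G)" "\<alpha> k \<in> Bij (carrier G)"
    using hom_in_carrier[OF action_hom] assms by (auto simp: AutoGroup_def auto_def)
  then show ?thesis
    using hom_mult[OF action_hom assms(1,2)] assms
    by (simp add: AutoGroup_def BijGroup_def compose_def)
qed

lemma action_one [simp]:
  assumes "a \<in> carrier G" shows "\<alpha> \<one>\<^bsub>H\<^esub> a = a"
proof -
  have "\<alpha> \<one>\<^bsub>H\<^esub> = \<one>\<^bsub>AutoGroup G\<^esub>"
    by (rule hom_one[OF action_hom H.is_group AutoGroup])
  then show ?thesis using assms by (simp add: AutoGroup_def BijGroup_def)
qed

lemma action_group_hom: "h \<in> carrier H \<Longrightarrow> group_hom G G (\<alpha> h)"
  by unfold_locales (auto simp: hom_def action_mult)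

lemma action_inv:
  "h \<in> carrier H \<Longrightarrow> a \<in> carrier G \<Longrightarrow> \<alpha> h (inv\<^bsub>G\<^esub> a) = inv\<^bsub>G\<^esub> (\<alpha> h a)"
  using group_hom.hom_inv[OF action_group_hom] by simp

lemma action_halo_mem:
  assumes "h \<in> carrier H" "Y \<subseteq> carrier H" "a \<in> L Y"
  shows "\<alpha> h a \<in> L (h <#\<^bsub>H\<^esub> Y)"
  using action_halo[OF assms(1,2)] assms(3) by auto

lemma group_LH: "group LH"
proof (rule groupI)
  show "\<exists>y \<in> carrier LH. y \<otimes>\<^bsub>LH\<^esub> x = \<one>\<^bsub>LH\<^esub>" if "x \<in> carrier LH" for x
  proof -
    obtain a h where "x = (a, h)" by (cases x)
    then have x: "x = (a, h)" "a \<in> carrier G" "h \<in> carrier H" using that by auto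
    have "\<alpha> (inv\<^bsub>H\<^esub> h) (inv\<^bsub>G\<^esub> a) \<otimes>\<^bsub>G\<^esub> \<alpha> (inv\<^bsub>H\<^esub> h) a = \<one>\<^bsub>G\<^esub>"
      using x by (simp add: action_inv)
    then show ?thesis using x by (intro bexI[of _ "(\<alpha> (inv\<^bsub>H\<^esub> h) (inv\<^bsub>G\<^esub> a), inv\<^bsub>H\<^esub> h)"]) auto
  qed
qed (auto simp: action_mult action_comp m_assoc H.m_assoc)

lemma halo_carrier: "Y \<subseteq> carrier H \<Longrightarrow> L Y \<subseteq> carrier G"
  using halo_mono[of Y "carrier H"] halo_top by auto

lemma halo_finite_support:
  assumes "g \<in> carrier G"
  shows "\<exists>Y \<subseteq> carrier H. finite Y \<and> g \<in> L Y"
proof -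
  have "g \<in> generate G (\<Union>S \<in> {S. S \<subseteq> carrier H \<and> finite S}. L S)"
    using assms halo_generated by simp
  then show ?thesis
  proof (induction rule: generate.induct)
    case one
    show ?case using halo_empty by (intro exI[of _ "{}"]) auto
  next
    case (inv h)
    then show ?case using subgroup.m_inv_closed[OF halo_subgroup] by blast
  next
    case (eng h1 h2)
    then obtain Y1 Y2 where Y: "Y1 \<subseteq> carrier H" "finite Y1" "h1 \<in> L Y1" "Y2 \<subseteq> carrier H" "finite Y2" "h2 \<in> L Y2"
      by auto
    then have "h1 \<in> L (Y1 \<union> Y2)" "h2 \<in> L (Y1 \<union> Y2)"
      using halo_mono[of Y1 "Y1 \<union> Y2"] halo_mono[of Y2 "Y1 \<union> Y2"] by auto
    then have "h1 \<otimes>\<^bsub>G\<^esub> h2 \<in> L (Y1 \<union> Y2)"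
      using Y subgroup.m_closed[OF halo_subgroup[of "Y1 \<union> Y2"]] by auto
    then show ?case using Y by (intro exI[of _ "Y1 \<union> Y2"]) auto
  qed blast
qed

lemma halo_finite_support_set:
  assumes "finite B" "B \<subseteq> carrier G"
  shows "\<exists>Y \<subseteq> carrier H. finite Y \<and> B \<subseteq> L Y"
  using assms
proof (induction B)
  case (insert b B)
  then obtain Y where Y: "Y \<subseteq> carrier H" "finite Y" "B \<subseteq> L Y" by auto
  obtain Z where Z: "Z \<subseteq> carrier H" "finite Z" "b \<in> L Z" using halo_finite_support[of b] insert.prems by auto
  have "L Y \<subseteq> L (Y \<union> Z)" "L Z \<subseteq> L (Y \<union> Z)"
    using Y(1) Z(1) by (simp_all add: halo_mono)
  then have "insert b B \<subseteq> L (Y \<union> Z)" using Y(3) Z(3) by blast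
  then show ?case using Y(1,2) Z(1,2) by (intro exI[of _ "Y \<union> Z"]) simp
qed auto

lemma halo_avoid:
  assumes "finite F" "F \<subseteq> carrier H" "J \<subseteq> carrier H" "g \<in> L J"
    "\<And>p. p \<in> F \<Longrightarrow> g \<in> L (carrier H - {p})"
  shows "g \<in> L (J - F)"
  using assms
proof (induction F)
  case (insert p F)
  have "g \<in> L (J - F) \<inter> L (carrier H - {p})" using insert by auto
  also have "\<dots> = L ((J - F) \<inter> (carrier H - {p}))" using insert by (intro halo_Int) auto
  also have "(J - F) \<inter> (carrier H - {p}) = J - insert p F" using insert by auto
  finally show ?case .
qed simp

lemma halo_avoid_all:
  assumes "g \<in> carrier G" "\<And>p. p \<in> carrier H \<Longrightarrow> g \<in> L (carrier H - {p})"
  shows "g = \<one>\<^bsub>G\<^esub>"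
proof -
  obtain J where "J \<subseteq> carrier H" "finite J" "g \<in> L J" using halo_finite_support[OF assms(1)] by auto
  then have "g \<in> L (J - J)" using assms(2) halo_avoid[of J J g] by blast
  then show ?thesis using halo_empty by simp
qed

end

section \<open>One-ended finitely presented subgroups of halo products\<close>

locale one_ended_halo_subgroup = halo_product_data H G L \<alpha>
  for H :: "'h monoid" and G :: "'g monoid" and L :: "'h set \<Rightarrow> 'g set" and \<alpha> +
  fixes K S :: "('g \<times> 'h) set" and n :: nat
  assumes locally_finite: "locally_finite_group G"
    and subgroup_K: "subgroup K LH"
    and one_ended_K: "one_ended (LH\<lparr>carrier := K\<rparr>)"
    and generating_K: "finite_generating_set (LH\<lparr>carrier := K\<rparr>) S"
    and boundaries_K: "coarsely_connected_boundaries (cayley_edges (LH\<lparr>carrier := K\<rparr>) S) K n"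
begin

abbreviation K_group :: "('g \<times> 'h) monoid" where
  "K_group \<equiv> LH\<lparr>carrier := K\<rparr>"

definition steps :: "('g \<times> 'h) set" where
  "steps = S \<union> m_inv K_group ` S"

lemma group_K: "group K_group"
  by (rule subgroup.subgroup_is_group[OF subgroup_K group_LH])

lemma K_mem: "x \<in> K \<Longrightarrow> fst x \<in> carrier G" "x \<in> K \<Longrightarrow> snd x \<in> carrier H"
  using subgroup.subset[OF subgroup_K] by auto

lemma steps: "finite steps" "steps \<subseteq> K"
  using generating_K group.inv_closed[OF group_K]
  unfolding steps_def finite_generating_set_def by auto

lemma edge_step:
  "(x, y) \<in> cayley_edges K_group S \<Longrightarrow> x \<in> K \<and> (\<exists>s \<in> steps. y = x \<otimes>\<^bsub>LH\<^esub> s)"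
  unfolding cayley_edges_def steps_def by (fastforce simp del: semidirect_product_simps)

lemma linked_displacement:
  assumes M: "subgroup M G" and x: "x \<in> K"
    and s: "\<And>y s. y \<in> V \<Longrightarrow> y \<in> K \<Longrightarrow> s \<in> steps \<Longrightarrow> \<alpha> (snd y) (fst s) \<in> M"
    and y: "(x, y) \<in> linked (cayley_edges K_group S) V"
  shows "inv\<^bsub>G\<^esub> (fst x) \<otimes>\<^bsub>G\<^esub> fst y \<in> M"
  using y
proof (induction rule: linked_induct)
  case refl
  show ?case using K_mem[OF x] subgroup.one_closed[OF M] by simp
next
  case (step y z)
  then obtain s where s': "y \<in> K" "s \<in> steps" "z = y \<otimes>\<^bsub>LH\<^esub> s" using edge_step by blast
  have "s \<in> K" using s' steps by auto
  then have c: "fst y \<in> carrier G" "snd y \<in> carrier H" "fst s \<in> carrier G"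
    using s' K_mem by simp_all
  have "inv\<^bsub>G\<^esub> (fst x) \<otimes>\<^bsub>G\<^esub> fst z = inv\<^bsub>G\<^esub> (fst x) \<otimes>\<^bsub>G\<^esub> fst y \<otimes>\<^bsub>G\<^esub> \<alpha> (snd y) (fst s)"
    using s'(3) c K_mem[OF x] by (simp add: m_assoc)
  then show ?case using step.IH s[OF step(2) s'(1,2)] subgroup.m_closed[OF M] by simp
qed

text \<open>Along a walk in the preimage of a finite subset of \<open>H\<close> the first component changes within a
  coset of a finitely generated, hence finite, subgroup.\<close>

lemma finite_components_K:
  assumes V: "V \<subseteq> K" "finite (snd ` V)" and x: "x \<in> K"
  shows "finite (linked (cayley_edges K_group S) V `` {x})"
proof -
  define B where "B = (\<lambda>(h, s). \<alpha> h (fst s)) ` (snd ` V \<times> steps)"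
  have "\<alpha> (snd y) (fst s) \<in> carrier G" if "y \<in> V" "s \<in> steps" for y s
    using that V(1) steps(2) K_mem by (intro action_closed) blast+
  then have B: "finite B" "B \<subseteq> carrier G"
    unfolding B_def using V steps by fastforce+
  let ?M = "generate G B"
  have M: "finite ?M" using locally_finite B unfolding locally_finite_group_def by auto
  have "linked (cayley_edges K_group S) V `` {x}
    \<subseteq> (\<lambda>(m, h). (fst x \<otimes>\<^bsub>G\<^esub> m, h)) ` (?M \<times> insert (snd x) (snd ` V))"
  proof
    fix y assume "y \<in> linked (cayley_edges K_group S) V `` {x}"
    then have y: "(x, y) \<in> linked (cayley_edges K_group S) V" by simp
    have "inv\<^bsub>G\<^esub> (fst x) \<otimes>\<^bsub>G\<^esub> fst y \<in> ?M"
    proof (rule linked_displacement[OF generate_is_subgroup[OF B(2)] x _ y])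
      show "\<alpha> (snd z) (fst s) \<in> ?M" if "z \<in> V" "z \<in> K" "s \<in> steps" for z s
        using that by (intro generate.incl) (force simp: B_def)
    qed
    moreover have y': "x = y \<or> y \<in> V" using linked_cases[OF y] by auto
    moreover have "fst y \<in> carrier G" using y' V(1) x K_mem(1)[of y] by blast
    then have "y = (fst x \<otimes>\<^bsub>G\<^esub> (inv\<^bsub>G\<^esub> (fst x) \<otimes>\<^bsub>G\<^esub> fst y), snd y)"
      using K_mem[OF x] by (simp add: m_assoc[symmetric])
    ultimately show "y \<in> (\<lambda>(m, h). (fst x \<otimes>\<^bsub>G\<^esub> m, h)) ` (?M \<times> insert (snd x) (snd ` V))"
      by (intro image_eqI[of _ _ "(inv\<^bsub>G\<^esub> (fst x) \<otimes>\<^bsub>G\<^esub> fst y, snd y)"]) auto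
  qed
  then show ?thesis by (rule finite_subset) (use M V in simp)
qed

definition D :: "'h set" where
  "D = (SOME Y. Y \<subseteq> carrier H \<and> finite Y \<and> fst ` steps \<subseteq> L Y)"

lemma D: "D \<subseteq> carrier H" "finite D" "fst ` steps \<subseteq> L D"
proof -
  have "\<exists>Y. Y \<subseteq> carrier H \<and> finite Y \<and> fst ` steps \<subseteq> L Y"
    using steps K_mem by (intro halo_finite_support_set) auto
  then have "D \<subseteq> carrier H \<and> finite D \<and> fst ` steps \<subseteq> L D"
    unfolding D_def by (rule someI_ex)
  then show "D \<subseteq> carrier H" "finite D" "fst ` steps \<subseteq> L D" by auto
qed

sublocale K: one_ended_over K_group H snd S n D
proof -
  interpret K: group K_group by (rule group_K)
  show "one_ended_over K_group H snd S n D"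
  proof
    show "snd \<in> hom K_group H" using K_mem by (auto simp: hom_def)
    show "finite (linked (cayley_edges K_group S) V `` {x})"
      if "V \<subseteq> carrier K_group" "finite (snd ` V)" "x \<in> carrier K_group" for V x
      using that by (intro finite_components_K) auto
  qed (use one_ended_K generating_K boundaries_K D in auto)
qed

text \<open>A walk in \<open>K\<close> that stays away from \<open>Q\<close> changes the first component outside \<open>Q\<close> only.  Hence
  the points outside \<open>Q\<close> agree on a coset of \<open>L(H - Q)\<close>, the configuration on \<open>Q\<close> at infinity.\<close>

lemma outside_agree:
  assumes Q: "finite Q" "Q \<subseteq> carrier H" and x: "x \<in> K.outside Q" and y: "y \<in> K.outside Q"
  shows "inv\<^bsub>G\<^esub> (fst x) \<otimes>\<^bsub>G\<^esub> fst y \<in> L (carrier H - Q)"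
proof (rule linked_displacement)
  show "subgroup (L (carrier H - Q)) G" by (rule halo_subgroup) auto
  show "x \<in> K" using x by (simp add: K.outside_def)
  show "(x, y) \<in> linked (cayley_edges K_group S) (K - K.touch Q)"
    using K.outside_linked[OF assms] by simp
  fix z s assume z: "z \<in> K - K.touch Q" and s: "s \<in> steps"
  have zc: "snd z \<in> carrier H" using z K_mem by auto
  have "\<alpha> (snd z) (fst s) \<in> L (snd z <#\<^bsub>H\<^esub> D)"
    using s D zc by (intro action_halo_mem) auto
  moreover have "snd z <#\<^bsub>H\<^esub> D \<subseteq> carrier H - Q"
    using z D zc unfolding K.touch_def l_coset_def by auto
  ultimately show "\<alpha> (snd z) (fst s) \<in> L (carrier H - Q)"
    using halo_mono[of "snd z <#\<^bsub>H\<^esub> D" "carrier H - Q"] by auto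
qed

lemma exceptional_points_finite: "finite {p \<in> carrier H. \<one>\<^bsub>LH\<^esub> \<notin> K.outside {p}}"
proof -
  have "{p \<in> carrier H. \<one>\<^bsub>LH\<^esub> \<notin> K.outside {p}}
    = {p \<in> carrier H. \<one>\<^bsub>K_group\<^esub> \<notin> K.outside (p <#\<^bsub>H\<^esub> {\<one>\<^bsub>H\<^esub>})}"
    by (auto simp: l_coset_def)
  also have "finite \<dots>" by (rule K.finite_not_outside) auto
  finally show ?thesis .
qed

text \<open>Fullness glues the configurations at infinity.  The identity is outside all but the finitely
  many points of \<open>R\<close>.  A point \<open>y\<close> outside a neighbourhood of \<open>R\<close> thus has its first component supported
  in \<open>R\<close> and in a finite set \<open>Y\<close> far from \<open>R\<close>.  A point \<open>x\<close> outside an even larger finite set has its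
  first component supported in \<open>R\<close> and in a set \<open>T\<close> far from \<open>R\<close> and from \<open>Y\<close>, and it differs from \<open>y\<close>
  only far from \<open>R\<close>.  So the first component of \<open>x\<close> splits into a part \<open>c\<close> in \<open>R\<close> and a part in
  \<open>T\<close>.\<close>

lemma configuration_at_infinity:
  assumes A: "finite_generating_set H A" and full: "full_halo G (carrier H) (word_dist H A) L"
  shows "\<exists>c \<in> carrier G. \<forall>p \<in> carrier H. \<forall>z \<in> K.outside {p}. inv\<^bsub>G\<^esub> c \<otimes>\<^bsub>G\<^esub> fst z \<in> L (carrier H - {p})"
proof -
  obtain \<kappa> :: real where \<kappa>: "\<forall>R S T U. R \<subseteq> carrier H \<and> S \<subseteq> carrier H \<and> T \<subseteq> carrier H \<and> U \<subseteq> carrier H \<and>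
      set_dist (word_dist H A) R S \<ge> \<kappa> \<and> set_dist (word_dist H A) R T \<ge> \<kappa> \<and>
      set_dist (word_dist H A) R U \<ge> \<kappa> \<and> set_dist (word_dist H A) S T \<ge> \<kappa> \<longrightarrow>
      (L (R \<union> S) <#>\<^bsub>G\<^esub> L U) \<inter> L (R \<union> T) \<subseteq> L R <#>\<^bsub>G\<^esub> L T"
    using full unfolding full_halo_def by (elim exE conjE)
  let ?nbhd = "neighbourhood H A \<kappa>"
  have nbhd: "?nbhd Z \<subseteq> carrier H" for Z unfolding neighbourhood_def by auto
  define R where "R = {p \<in> carrier H. \<one>\<^bsub>LH\<^esub> \<notin> K.outside {p}}"
  have R: "finite R" "R \<subseteq> carrier H" using exceptional_points_finite unfolding R_def by auto
  have regular: "fst z \<in> L (carrier H - {p})" if "p \<in> carrier H - R" "z \<in> K.outside {p}" for p z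
  proof -
    have "inv\<^bsub>G\<^esub> (fst \<one>\<^bsub>LH\<^esub>) \<otimes>\<^bsub>G\<^esub> fst z \<in> L (carrier H - {p})"
      using that by (intro outside_agree) (auto simp: R_def)
    moreover have "fst z \<in> carrier G" using that(2) K_mem by (simp add: K.outside_def)
    ultimately show ?thesis by simp
  qed
  have supported: "fst z \<in> L (J - (F - R))"
    if F: "finite F" "F \<subseteq> carrier H" and z: "z \<in> K.outside F" and J: "J \<subseteq> carrier H" "fst z \<in> L J" for z F J
  proof (rule halo_avoid[OF _ _ J])
    show "fst z \<in> L (carrier H - {p})" if "p \<in> F - R" for p
      using that F z K.outside_mono[of "{p}" F] by (intro regular) auto
  qed (use F in auto)
  let ?R' = "?nbhd R"
  have R': "finite ?R'" by (rule H.finite_neighbourhood[OF A R])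
  obtain y where y: "y \<in> K.outside ?R'" using K.outside_nonempty[OF R' nbhd] by auto
  have yc: "fst y \<in> carrier G" using y K_mem by (simp add: K.outside_def)
  obtain J where J: "J \<subseteq> carrier H" "finite J" "fst y \<in> L J" using halo_finite_support[OF yc] by auto
  define Y where "Y = J - ?R'"
  have Y: "finite Y" "Y \<subseteq> carrier H" unfolding Y_def using J by auto
  \<comment> \<open>For \<open>\<kappa> = 0\<close> all neighbourhoods are empty, so \<open>R\<close> itself has to be added.\<close>
  define F where "F = R \<union> ?R' \<union> ?nbhd Y"
  have F: "finite F" "F \<subseteq> carrier H"
    unfolding F_def using R R' nbhd H.finite_neighbourhood[OF A Y] by auto
  obtain x where x: "x \<in> K.outside F" using K.outside_nonempty[OF F] by auto
  have xc: "fst x \<in> carrier G" using x K_mem by (simp add: K.outside_def)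
  define T where "T = carrier H - F"
  define U where "U = carrier H - ?R'"
  have "fst y \<in> L (J - (?R' - R))" by (rule supported[OF R' nbhd y J(1,3)])
  moreover have "J - (?R' - R) \<subseteq> R \<union> Y" unfolding Y_def by auto
  ultimately have yL: "fst y \<in> L (R \<union> Y)" using halo_mono R Y by (meson Un_least subsetD)
  have "fst x \<in> L (carrier H - (F - R))" using supported[OF F x subset_refl] xc halo_top by simp
  also have "carrier H - (F - R) = R \<union> T" unfolding T_def using R by auto
  finally have xL: "fst x \<in> L (R \<union> T)" .
  have "inv\<^bsub>G\<^esub> (fst y) \<otimes>\<^bsub>G\<^esub> fst x \<in> L U"
    unfolding U_def using K.outside_mono[of ?R' F] x by (intro outside_agree[OF R' nbhd y]) (auto simp: F_def)
  then have "fst y \<otimes>\<^bsub>G\<^esub> (inv\<^bsub>G\<^esub> (fst y) \<otimes>\<^bsub>G\<^esub> fst x) \<in> L (R \<union> Y) <#>\<^bsub>G\<^esub> L U"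
    using yL unfolding set_mult_def by auto
  moreover have "fst y \<otimes>\<^bsub>G\<^esub> (inv\<^bsub>G\<^esub> (fst y) \<otimes>\<^bsub>G\<^esub> fst x) = fst x" using xc yc by (simp add: m_assoc[symmetric])
  moreover have "(L (R \<union> Y) <#>\<^bsub>G\<^esub> L U) \<inter> L (R \<union> T) \<subseteq> L R <#>\<^bsub>G\<^esub> L T"
  proof (rule \<kappa>[rule_format], intro conjI)
    show "R \<subseteq> carrier H" "Y \<subseteq> carrier H" by (fact R Y)+
    show "T \<subseteq> carrier H" "U \<subseteq> carrier H" by (auto simp: T_def U_def)
  qed (use Y in \<open>auto intro!: set_dist_outside_neighbourhood simp: T_def U_def Y_def F_def\<close>)
  ultimately have "fst x \<in> L R <#>\<^bsub>G\<^esub> L T" using xL by auto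
  then obtain c t where ct: "c \<in> L R" "t \<in> L T" "fst x = c \<otimes>\<^bsub>G\<^esub> t" unfolding set_mult_def by auto
  have c: "c \<in> carrier G" using ct(1) halo_carrier[OF R(2)] by auto
  have t: "t \<in> carrier G" using ct(2) halo_carrier[of T] by (auto simp: T_def)
  have "inv\<^bsub>G\<^esub> c \<otimes>\<^bsub>G\<^esub> fst z \<in> L (carrier H - {p})" if p: "p \<in> carrier H" and z: "z \<in> K.outside {p}" for p z
  proof -
    have zc: "fst z \<in> carrier G" using z K_mem by (simp add: K.outside_def)
    have Lp: "subgroup (L (carrier H - {p})) G" by (rule halo_subgroup) auto
    show ?thesis
    proof (cases "p \<in> F")
      case True
      have "inv\<^bsub>G\<^esub> (fst x) \<otimes>\<^bsub>G\<^esub> fst z \<in> L (carrier H - {p})"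
        using True p z x K.outside_mono[of "{p}" F] by (intro outside_agree) auto
      moreover have "t \<in> L (carrier H - {p})"
        using ct(2) halo_mono[of T "carrier H - {p}"] True by (auto simp: T_def)
      ultimately have "t \<otimes>\<^bsub>G\<^esub> (inv\<^bsub>G\<^esub> (fst x) \<otimes>\<^bsub>G\<^esub> fst z) \<in> L (carrier H - {p})"
        using subgroup.m_closed[OF Lp] by auto
      moreover have "t \<otimes>\<^bsub>G\<^esub> (inv\<^bsub>G\<^esub> (fst x) \<otimes>\<^bsub>G\<^esub> fst z) = inv\<^bsub>G\<^esub> c \<otimes>\<^bsub>G\<^esub> fst z"
        using c t zc ct(3) by (simp add: inv_mult_group m_assoc[symmetric])
      ultimately show ?thesis by simp
    next
      case False
      then have "p \<notin> R" by (simp add: F_def)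
      then have "c \<in> L (carrier H - {p})" "fst z \<in> L (carrier H - {p})"
        using ct(1) halo_mono[of R "carrier H - {p}"] R regular p z by auto
      then show ?thesis using subgroup.m_closed[OF Lp] subgroup.m_inv_closed[OF Lp] by auto
    qed
  qed
  then show ?thesis using c by blast
qed

text \<open>By equivariance \<open>c\<close> and its translate under an element of \<open>K\<close> are both the configuration at
  infinity, and a configuration is determined by its values at all points.\<close>

lemma configuration_at_infinity_fixed:
  assumes c: "c \<in> carrier G"
    and infinity: "\<And>p z. p \<in> carrier H \<Longrightarrow> z \<in> K.outside {p} \<Longrightarrow> inv\<^bsub>G\<^esub> c \<otimes>\<^bsub>G\<^esub> fst z \<in> L (carrier H - {p})"
    and k: "k \<in> K"
  shows "fst k \<otimes>\<^bsub>G\<^esub> \<alpha> (snd k) c = c"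
proof -
  let ?b = "fst k" and ?h = "snd k"
  have bh: "?b \<in> carrier G" "?h \<in> carrier H" using K_mem[OF k] by auto
  have "inv\<^bsub>G\<^esub> c \<otimes>\<^bsub>G\<^esub> (?b \<otimes>\<^bsub>G\<^esub> \<alpha> ?h c) = \<one>\<^bsub>G\<^esub>"
  proof (rule halo_avoid_all)
    fix p assume p: "p \<in> carrier H"
    have Lp: "subgroup (L (carrier H - {p})) G" by (rule halo_subgroup) auto
    define q where "q = inv\<^bsub>H\<^esub> ?h \<otimes>\<^bsub>H\<^esub> p"
    have q: "q \<in> carrier H" "?h \<otimes>\<^bsub>H\<^esub> q = p"
      unfolding q_def using bh p by (auto simp: H.m_assoc[symmetric])
    obtain z where z: "z \<in> K.outside {q}" using K.outside_nonempty[of "{q}"] q by auto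
    have zc: "fst z \<in> carrier G" using z K_mem by (simp add: K.outside_def)
    have "k \<otimes>\<^bsub>K_group\<^esub> z \<in> K.outside (?h <#\<^bsub>H\<^esub> {q})"
      using k q z by (intro K.outside_left_mult) auto
    then have "inv\<^bsub>G\<^esub> c \<otimes>\<^bsub>G\<^esub> (?b \<otimes>\<^bsub>G\<^esub> \<alpha> ?h (fst z)) \<in> L (carrier H - {p})" (is "?u \<in> _")
      using infinity[OF p, of "k \<otimes>\<^bsub>LH\<^esub> z"] q by (simp add: l_coset_def)
    moreover have "\<alpha> ?h (inv\<^bsub>G\<^esub> c \<otimes>\<^bsub>G\<^esub> fst z) \<in> L (carrier H - {p})" (is "?v \<in> _")
    proof -
      have "?v \<in> L (?h <#\<^bsub>H\<^esub> (carrier H - {q}))"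
        using infinity[OF q(1) z] bh by (intro action_halo_mem) auto
      moreover have "?h <#\<^bsub>H\<^esub> (carrier H - {q}) \<subseteq> carrier H - {p}"
        using bh q by (auto simp: l_coset_def)
      ultimately show ?thesis using halo_mono by blast
    qed
    ultimately have "?u \<otimes>\<^bsub>G\<^esub> inv\<^bsub>G\<^esub> ?v \<in> L (carrier H - {p})"
      using subgroup.m_closed[OF Lp] subgroup.m_inv_closed[OF Lp] by auto
    moreover have "inv\<^bsub>G\<^esub> ?v = inv\<^bsub>G\<^esub> (\<alpha> ?h (fst z)) \<otimes>\<^bsub>G\<^esub> \<alpha> ?h c"
      using bh c zc by (simp add: action_mult action_inv inv_mult_group)
    moreover have "\<alpha> ?h (fst z) \<otimes>\<^bsub>G\<^esub> (inv\<^bsub>G\<^esub> (\<alpha> ?h (fst z)) \<otimes>\<^bsub>G\<^esub> \<alpha> ?h c) = \<alpha> ?h c"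
      using bh c zc by (simp add: m_assoc[symmetric])
    ultimately have "?u \<otimes>\<^bsub>G\<^esub> inv\<^bsub>G\<^esub> ?v \<in> L (carrier H - {p})"
      "?u \<otimes>\<^bsub>G\<^esub> inv\<^bsub>G\<^esub> ?v = inv\<^bsub>G\<^esub> c \<otimes>\<^bsub>G\<^esub> (?b \<otimes>\<^bsub>G\<^esub> \<alpha> ?h c)"
      using bh c zc by (simp_all add: m_assoc)
    then show "inv\<^bsub>G\<^esub> c \<otimes>\<^bsub>G\<^esub> (?b \<otimes>\<^bsub>G\<^esub> \<alpha> ?h c) \<in> L (carrier H - {p})" by simp
  qed (use bh c in simp)
  then have "c \<otimes>\<^bsub>G\<^esub> (inv\<^bsub>G\<^esub> c \<otimes>\<^bsub>G\<^esub> (?b \<otimes>\<^bsub>G\<^esub> \<alpha> ?h c)) = c" using c by simp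
  then show ?thesis using bh c by (simp add: m_assoc[symmetric])
qed

text \<open>A fixed configuration exhibits the first component of the elements of \<open>K\<close> as a coboundary, which
  a conjugation removes.\<close>

lemma conjugate_into_H:
  assumes c: "c \<in> carrier G" and fixed: "\<And>k. k \<in> K \<Longrightarrow> fst k \<otimes>\<^bsub>G\<^esub> \<alpha> (snd k) c = c"
  shows "\<exists>g \<in> carrier LH. \<exists>Q. subgroup Q H \<and> g <#\<^bsub>LH\<^esub> (K #>\<^bsub>LH\<^esub> inv\<^bsub>LH\<^esub> g) = {\<one>\<^bsub>G\<^esub>} \<times> Q"
proof (intro bexI exI conjI)
  let ?g = "(inv\<^bsub>G\<^esub> c, \<one>\<^bsub>H\<^esub>)"
  show "?g \<in> carrier LH" using c by simp
  interpret LH: group LH by (rule group_LH)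
  have ginv: "inv\<^bsub>LH\<^esub> ?g = (c, \<one>\<^bsub>H\<^esub>)"
    using c by (intro LH.inv_equality) auto
  have "group_hom LH H snd"
    by (intro group_hom.intro group_hom_axioms.intro group_LH H.is_group) (auto simp: hom_def)
  then show "subgroup (snd ` K) H" by (rule group_hom.subgroup_img_is_subgroup[OF _ subgroup_K])
  have conj: "?g \<otimes>\<^bsub>LH\<^esub> (k \<otimes>\<^bsub>LH\<^esub> (c, \<one>\<^bsub>H\<^esub>)) = (\<one>\<^bsub>G\<^esub>, snd k)" if "k \<in> K" for k
    using fixed[OF that] K_mem[OF that] c by simp
  then show "?g <#\<^bsub>LH\<^esub> (K #>\<^bsub>LH\<^esub> inv\<^bsub>LH\<^esub> ?g) = {\<one>\<^bsub>G\<^esub>} \<times> snd ` K"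
    unfolding ginv l_coset_def r_coset_def by (auto simp del: semidirect_product_simps)
qed

end

theorem proposition1p4:
  fixes H :: "'h monoid" and G :: "'g monoid"
    and L :: "'h set \<Rightarrow> 'g set" and \<alpha> :: "'h \<Rightarrow> 'g \<Rightarrow> 'g"
    and A :: "'h set" and K :: "('g \<times> 'h) set"
  defines "LH \<equiv> semidirect_product G H \<alpha>"
  assumes "halo_product_data H G L \<alpha>"
    and "finitely_generated LH"
    and "finite_generating_set H A"
    and "full_halo G (carrier H) (word_dist H A) L"
    and "locally_finite_group G"
    and "subgroup K LH"
    and "one_ended (LH\<lparr>carrier := K\<rparr>)"
    and "finitely_presented (LH\<lparr>carrier := K\<rparr>)"
  shows "\<exists>g \<in> carrier LH. \<exists>Q. subgroup Q H \<and>
    g <#\<^bsub>LH\<^esub> (K #>\<^bsub>LH\<^esub> inv\<^bsub>LH\<^esub> g) = {\<one>\<^bsub>G\<^esub>} \<times> Q"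
proof -
  interpret halo_product_data H G L \<alpha> by (rule assms(2))
  have "group (LH\<lparr>carrier := K\<rparr>)"
    unfolding assms(1) using assms(7) group_LH subgroup.subgroup_is_group unfolding assms(1) by blast
  then obtain S n where "finite_generating_set (LH\<lparr>carrier := K\<rparr>) S"
    "coarsely_connected_boundaries (cayley_edges (LH\<lparr>carrier := K\<rparr>) S) K n"
    using finitely_presented_coarsely_connected_boundaries[OF assms(9)] by auto
  then interpret one_ended_halo_subgroup H G L \<alpha> K S n
    using assms(6-8) unfolding assms(1)
    by (intro one_ended_halo_subgroup.intro one_ended_halo_subgroup_axioms.intro assms(2))
  obtain c where "c \<in> carrier G"
    "\<And>p z. p \<in> carrier H \<Longrightarrow> z \<in> K.outside {p} \<Longrightarrow> inv\<^bsub>G\<^esub> c \<otimes>\<^bsub>G\<^esub> fst z \<in> L (carrier H - {p})"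
    using configuration_at_infinity[OF assms(4,5)] by blast
  then show ?thesis
    unfolding assms(1) using configuration_at_infinity_fixed by (intro conjugate_into_H) auto
qed

end
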